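(* Let $J\in\Omega^1(M;TM)$ be a complex structure on the manifold $M$. Then there exists a complex Lie algebroid structure $(T^{\mathbb{C}}M,q,[\![\cdot,\cdot]\!])$ on $M$, where the anchor map is $q=p^+=\frac{1}{2}(\mathrm{Id}-iJ)$ and the bracket is $$[\![Z,W]\!]=[Z,W]_{p^+}=\frac{1}{2}\left([Z,W]-i[Z,W]_J\right)$$ for all $Z,W\in\Gamma(T^{\mathbb{C}}M)$.
   Context: $T^{\mathbb{C}}M=TM\oplus iTM$ is the complexified tangent bundle; its sections are complex vector fields, and the Lie bracket and all real endomorphisms of $TM$ are extended to it by $\mathbb{C}$-linearity (with the same notation). An almost-complex structure on $M$ is a vector bundle endomorphism $J:TM\to TM$ with $J^2=-\mathrm{Id}_{TM}$. It is a complex structure (is integrable) if its Nijenhuis torsion vanishes: $T_J(X,Y)=[JX,JY]-J[JX,Y]-J[X,JY]-[X,Y]=0$ for all vector fields $X,Y$. For an endomorphism $N$ of $T^{\mathbb{C}}M$, the contracted bracket is $[Z,W]_N=[NZ,W]+[Z,NW]-N[Z,W]$. A complex Lie algebroid over $M$ is a complex vector bundle $E\to M$ with a complex Lie algebra structure $[\![\cdot,\cdot]\!]$ on $\Gamma(E)$ and a (complex) bundle map $q:E\to T^{\mathbb{C}}M$ (the anchor) such that $[\![A,fB]\!]=f[\![A,B]\!]+(qA)(f)\,B$ for all $A,B\in\Gamma(E)$ and all smooth $f:M\to\mathbb{C}$. *)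

theory Defs
  imports "HOL-Analysis.Analysis"
begin

section \<open>Smooth maps and smooth manifolds\<close>

text \<open>
  For an open subset \<open>S\<close> of a Euclidean space, \<open>Ck_on k S f\<close> says that all iterated directional
  derivatives of \<open>f\<close> of order at most \<open>k\<close> exist and are continuous on \<open>S\<close>.
\<close>

primrec Ck_on :: "nat \<Rightarrow> 'a::euclidean_space set \<Rightarrow> ('a \<Rightarrow> 'b::real_normed_vector) \<Rightarrow> bool" where
  "Ck_on 0 S f \<longleftrightarrow> continuous_on S f"
| "Ck_on (Suc k) S f \<longleftrightarrow>
     (\<forall>x\<in>S. f differentiable (at x)) \<and> (\<forall>v. Ck_on k S (\<lambda>x. frechet_derivative f (at x) v))"

definition smooth_on :: "'a::euclidean_space set \<Rightarrow> ('a \<Rightarrow> 'b::real_normed_vector) \<Rightarrow> bool" where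
  "smooth_on S f \<longleftrightarrow> (\<forall>k. Ck_on k S f)"

text \<open>
  A chart is a pair \<open>(U, \<phi>)\<close>; only the values of \<open>\<phi>\<close> on \<open>U\<close> matter, and \<open>inv_into U \<phi>\<close> is the
  inverse chart map. The manifold is the whole type \<open>'m\<close>; the Hausdorff and second countability
  conditions are the type class constraints \<open>t2_space\<close> and \<open>second_countable_topology\<close> on \<open>'m\<close>.
  Nothing below depends on which atlas of a given smooth structure is used.
\<close>

type_synonym ('m, 'n) chart = "'m set \<times> ('m \<Rightarrow> (real, 'n) vec)"

definition chart_inv :: "('m, 'n::finite) chart \<Rightarrow> real^'n \<Rightarrow> 'm" where
  "chart_inv c = inv_into (fst c) (snd c)"

definition transition :: "('m, 'n::finite) chart \<Rightarrow> ('m, 'n) chart \<Rightarrow> real^'n \<Rightarrow> real^'n" where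
  "transition c d = snd d \<circ> chart_inv c"

definition smooth_atlas :: "('m::topological_space, 'n::finite) chart set \<Rightarrow> bool" where
  "smooth_atlas A \<longleftrightarrow>
     (\<Union>c\<in>A. fst c) = UNIV \<and>
     (\<forall>c\<in>A. open (fst c) \<and> open (snd c ` fst c) \<and>
        homeomorphism (fst c) (snd c ` fst c) (snd c) (chart_inv c)) \<and>
     (\<forall>c\<in>A. \<forall>d\<in>A. smooth_on (snd c ` (fst c \<inter> fst d)) (transition c d))"

text \<open>Smoothness, on an open subset \<open>W\<close> of the manifold, of a map with values in a vector space.\<close>

definition mfd_smooth_on ::
    "('m, 'n::finite) chart set \<Rightarrow> 'm set \<Rightarrow> ('m \<Rightarrow> 'b::real_normed_vector) \<Rightarrow> bool" where
  "mfd_smooth_on A W f \<longleftrightarrow> (\<forall>c\<in>A. smooth_on (snd c ` (fst c \<inter> W)) (f \<circ> chart_inv c))"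


section \<open>Smooth vector bundles\<close>

text \<open>
  A vector bundle over the manifold \<open>'m\<close>, with scalars \<open>'k\<close> (\<open>real\<close> or \<open>complex\<close>) and typical
  fibre \<open>'k^'r\<close>. A local trivialization over \<open>U\<close> is stored as \<open>(U, \<tau>)\<close>, where \<open>\<tau>\<close> is the
  vector component of the trivialization \<open>e \<mapsto> (proj e, \<tau> e)\<close>. As usual, the topology and the smooth
  structure of the total space are the ones determined by the trivializations.
\<close>

record ('m, 'e, 'k, 'r) vbundle =
  total :: "'e set"
  proj  :: "'e \<Rightarrow> 'm"
  vadd  :: "'e \<Rightarrow> 'e \<Rightarrow> 'e"
  vzero :: "'m \<Rightarrow> 'e"
  vscale :: "'k \<Rightarrow> 'e \<Rightarrow> 'e"
  trivs :: "('m set \<times> ('e \<Rightarrow> ('k, 'r) vec)) set"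

definition fibre :: "('m, 'e, 'k, 'r) vbundle \<Rightarrow> 'm \<Rightarrow> 'e set" where
  "fibre E p = {e \<in> total E. proj E e = p}"

text \<open>
  The fibrewise vector space axioms need not be listed: they are transported from \<open>'k^'r\<close> by the
  fibrewise bijections \<open>\<tau>\<close>. Smoothness of the transition functions
  \<open>U \<inter> V \<rightarrow> GL\<close> is tested on vectors \<open>w\<close> of \<open>'k^'r\<close>.
\<close>

definition vector_bundle ::
    "('m::topological_space, 'n::finite) chart set
      \<Rightarrow> ('m, 'e, 'k::real_normed_field, 'r::finite) vbundle \<Rightarrow> bool" where
  "vector_bundle A E \<longleftrightarrow>
     (\<Union>(U, \<tau>)\<in>trivs E. U) = UNIV \<and>
     (\<forall>p. vzero E p \<in> fibre E p \<and>
        (\<forall>e\<in>fibre E p. \<forall>e'\<in>fibre E p. vadd E e e' \<in> fibre E p) \<and>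
        (\<forall>a. \<forall>e\<in>fibre E p. vscale E a e \<in> fibre E p)) \<and>
     (\<forall>(U, \<tau>)\<in>trivs E. open U \<and>
        (\<forall>p\<in>U. bij_betw \<tau> (fibre E p) UNIV \<and> \<tau> (vzero E p) = 0 \<and>
           (\<forall>e\<in>fibre E p. \<forall>e'\<in>fibre E p. \<tau> (vadd E e e') = \<tau> e + \<tau> e') \<and>
           (\<forall>a. \<forall>e\<in>fibre E p. \<tau> (vscale E a e) = a *s \<tau> e))) \<and>
     (\<forall>(U, \<tau>)\<in>trivs E. \<forall>(V, \<sigma>)\<in>trivs E. \<forall>w.
        mfd_smooth_on A (U \<inter> V) (\<lambda>p. \<sigma> (inv_into (fibre E p) \<tau> w)))"

text \<open>The space \<open>\<Gamma>(E)\<close> of global smooth sections, and its pointwise operations.\<close>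

definition sections ::
    "('m, 'n::finite) chart set \<Rightarrow> ('m, 'e, 'k::real_normed_field, 'r::finite) vbundle
      \<Rightarrow> ('m \<Rightarrow> 'e) set" where
  "sections A E = {s. (\<forall>p. s p \<in> fibre E p) \<and> (\<forall>(U, \<tau>)\<in>trivs E. mfd_smooth_on A U (\<tau> \<circ> s))}"

definition sec_add :: "('m, 'e, 'k, 'r) vbundle \<Rightarrow> ('m \<Rightarrow> 'e) \<Rightarrow> ('m \<Rightarrow> 'e) \<Rightarrow> 'm \<Rightarrow> 'e" where
  "sec_add E s t = (\<lambda>p. vadd E (s p) (t p))"

definition sec_scale :: "('m, 'e, 'k, 'r) vbundle \<Rightarrow> ('m \<Rightarrow> 'k) \<Rightarrow> ('m \<Rightarrow> 'e) \<Rightarrow> 'm \<Rightarrow> 'e" where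
  "sec_scale E f s = (\<lambda>p. vscale E (f p) (s p))"

definition sec_minus ::
    "('m, 'e, 'k::real_normed_field, 'r) vbundle \<Rightarrow> ('m \<Rightarrow> 'e) \<Rightarrow> ('m \<Rightarrow> 'e) \<Rightarrow> 'm \<Rightarrow> 'e" where
  "sec_minus E s t = sec_add E s (sec_scale E (\<lambda>_. - 1) t)"

text \<open>
  Smooth bundle maps over the identity of the base. A fibrewise linear map is smooth iff its matrix
  in local trivializations is, which is tested on vectors \<open>w\<close> of the typical fibre.
\<close>

definition bundle_map ::
    "('m, 'n::finite) chart set \<Rightarrow> ('m, 'e, 'k::real_normed_field, 'r::finite) vbundle
      \<Rightarrow> ('m, 'f, 'k, 's::finite) vbundle \<Rightarrow> ('e \<Rightarrow> 'f) \<Rightarrow> bool" where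
  "bundle_map A E F q \<longleftrightarrow>
     (\<forall>p. (\<forall>e\<in>fibre E p. q e \<in> fibre F p) \<and>
        (\<forall>e\<in>fibre E p. \<forall>e'\<in>fibre E p. q (vadd E e e') = vadd F (q e) (q e')) \<and>
        (\<forall>a. \<forall>e\<in>fibre E p. q (vscale E a e) = vscale F a (q e))) \<and>
     (\<forall>(U, \<tau>)\<in>trivs E. \<forall>(V, \<sigma>)\<in>trivs F. \<forall>w.
        mfd_smooth_on A (U \<inter> V) (\<lambda>p. \<sigma> (q (inv_into (fibre E p) \<tau> w))))"

text \<open>
  The complexification \<open>E \<oplus> iE\<close> of a real vector bundle; the pair \<open>(u, v)\<close> stands for \<open>u + i v\<close>.
\<close>

definition complexification ::
    "('m, 'e, real, 'r::finite) vbundle \<Rightarrow> ('m, 'e \<times> 'e, complex, 'r) vbundle" where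
  "complexification E =
     \<lparr> total = {(u, v). u \<in> total E \<and> v \<in> total E \<and> proj E u = proj E v},
       proj = (\<lambda>(u, v). proj E u),
       vadd = (\<lambda>(u, v) (u', v'). (vadd E u u', vadd E v v')),
       vzero = (\<lambda>p. (vzero E p, vzero E p)),
       vscale = (\<lambda>a (u, v).
         (vadd E (vscale E (Re a) u) (vscale E (- Im a) v),
          vadd E (vscale E (Re a) v) (vscale E (Im a) u))),
       trivs = (\<lambda>(U, \<tau>). (U, \<lambda>(u, v). \<chi> i. Complex (\<tau> u $ i) (\<tau> v $ i))) ` trivs E \<rparr>"

text \<open>The \<open>\<complex>\<close>-linear extension \<open>u + i v \<mapsto> N u + i N v\<close> of a real endomorphism \<open>N\<close>.\<close>

definition complexify_end :: "('e \<Rightarrow> 'e) \<Rightarrow> 'e \<times> 'e \<Rightarrow> 'e \<times> 'e" where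
  "complexify_end N = map_prod N N"


section \<open>Tangent bundle and Lie bracket\<close>

text \<open>
  A tangent vector at \<open>p\<close> assigns to every chart around \<open>p\<close> a coordinate vector, in such a way that
  coordinate vectors with respect to different charts are related by the derivative of the
  transition map. The value at all other pairs \<open>c\<close> is fixed to be \<open>0\<close>, so that equality of
  tangent vectors is equality of their representations.
\<close>

type_synonym ('m, 'n) tvec = "'m \<times> (('m, 'n) chart \<Rightarrow> (real, 'n) vec)"

definition charts_at :: "('m, 'n) chart set \<Rightarrow> 'm \<Rightarrow> ('m, 'n) chart set" where
  "charts_at A p = {c \<in> A. p \<in> fst c}"

definition tangent_bundle ::
    "('m, 'n::finite) chart set \<Rightarrow> ('m, ('m, 'n) tvec, real, 'n) vbundle" where
  "tangent_bundle A =
     \<lparr> total = {(p, v).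
         (\<forall>c\<in>charts_at A p. \<forall>d\<in>charts_at A p.
            v d = frechet_derivative (transition c d) (at (snd c p)) (v c)) \<and>
         (\<forall>c. c \<notin> charts_at A p \<longrightarrow> v c = 0)},
       proj = fst,
       vadd = (\<lambda>(p, v) (p', v'). (p, \<lambda>c. v c + v' c)),
       vzero = (\<lambda>p. (p, \<lambda>c. 0)),
       vscale = (\<lambda>a (p, v). (p, \<lambda>c. a *s v c)),
       trivs = (\<lambda>c. (fst c, \<lambda>e. snd e c)) ` A \<rparr>"

text \<open>
  The directional derivative of a function along a tangent vector, computed in any chart around its
  base point (the result does not depend on the chart).
\<close>

definition tangent_act ::
    "('m, 'n::finite) chart set \<Rightarrow> ('m, 'n) tvec \<Rightarrow> ('m \<Rightarrow> 'b::real_normed_vector) \<Rightarrow> 'b" where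
  "tangent_act A e f =
     (let p = fst e; c = (SOME c. c \<in> charts_at A p)
      in frechet_derivative (f \<circ> chart_inv c) (at (snd c p)) (snd e c))"

definition coord_field ::
    "('m, 'n::finite) chart \<Rightarrow> ('m \<Rightarrow> ('m, 'n) tvec) \<Rightarrow> real^'n \<Rightarrow> real^'n" where
  "coord_field c X = (\<lambda>x. snd (X (chart_inv c x)) c)"

text \<open>
  In local coordinates \<open>[X,Y]\<^sup>j = \<Sum>\<^sub>i (X\<^sup>i \<partial>\<^sub>i Y\<^sup>j - Y\<^sup>i \<partial>\<^sub>i X\<^sup>j)\<close>.
\<close>

definition lie_bracket ::
    "('m, 'n::finite) chart set \<Rightarrow> ('m \<Rightarrow> ('m, 'n) tvec) \<Rightarrow> ('m \<Rightarrow> ('m, 'n) tvec)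
      \<Rightarrow> 'm \<Rightarrow> ('m, 'n) tvec" where
  "lie_bracket A X Y = (\<lambda>p. (p, \<lambda>c.
     if c \<in> charts_at A p
     then frechet_derivative (coord_field c Y) (at (snd c p)) (snd (X p) c)
        - frechet_derivative (coord_field c X) (at (snd c p)) (snd (Y p) c)
     else 0))"

type_synonym ('m, 'n) ctvec = "('m, 'n) tvec \<times> ('m, 'n) tvec"

abbreviation ctangent_bundle ::
    "('m, 'n::finite) chart set \<Rightarrow> ('m, ('m, 'n) ctvec, complex, 'n) vbundle" where
  "ctangent_bundle A \<equiv> complexification (tangent_bundle A)"

text \<open>The value \<open>Z(f)\<close> of a complex vector field on a complex function: \<open>(X + i Y)(f) = X f + i Y f\<close>.\<close>

definition cfield_act ::
    "('m, 'n::finite) chart set \<Rightarrow> ('m \<Rightarrow> ('m, 'n) ctvec) \<Rightarrow> ('m \<Rightarrow> complex) \<Rightarrow> 'm \<Rightarrow> complex" where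
  "cfield_act A Z f = (\<lambda>p. tangent_act A (fst (Z p)) f + \<i> * tangent_act A (snd (Z p)) f)"

text \<open>
  \<open>\<complex>\<close>-bilinear extension: \<open>[X + iY, X' + iY'] = ([X,X'] - [Y,Y']) + i ([X,Y'] + [Y,X'])\<close>.
\<close>

definition clie_bracket ::
    "('m, 'n::finite) chart set \<Rightarrow> ('m \<Rightarrow> ('m, 'n) ctvec) \<Rightarrow> ('m \<Rightarrow> ('m, 'n) ctvec)
      \<Rightarrow> 'm \<Rightarrow> ('m, 'n) ctvec" where
  "clie_bracket A Z W =
     (let X = fst \<circ> Z; Y = snd \<circ> Z; X' = fst \<circ> W; Y' = snd \<circ> W; T = tangent_bundle A
      in (\<lambda>p. (sec_minus T (lie_bracket A X X') (lie_bracket A Y Y') p,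
               sec_add T (lie_bracket A X Y') (lie_bracket A Y X') p)))"

text \<open>\<open>[Z,W]\<^sub>N = [NZ,W] + [Z,NW] - N[Z,W]\<close> for an endomorphism \<open>N\<close> of the complexified tangent bundle.\<close>

definition contracted_bracket ::
    "('m, 'n::finite) chart set \<Rightarrow> (('m, 'n) ctvec \<Rightarrow> ('m, 'n) ctvec)
      \<Rightarrow> ('m \<Rightarrow> ('m, 'n) ctvec) \<Rightarrow> ('m \<Rightarrow> ('m, 'n) ctvec) \<Rightarrow> 'm \<Rightarrow> ('m, 'n) ctvec" where
  "contracted_bracket A N Z W =
     (let T = ctangent_bundle A
      in sec_minus T
           (sec_add T (clie_bracket A (N \<circ> Z) W) (clie_bracket A Z (N \<circ> W)))
           (N \<circ> clie_bracket A Z W))"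


section \<open>Complex structures\<close>

definition almost_complex_structure ::
    "('m, 'n::finite) chart set \<Rightarrow> (('m, 'n) tvec \<Rightarrow> ('m, 'n) tvec) \<Rightarrow> bool" where
  "almost_complex_structure A J \<longleftrightarrow>
     bundle_map A (tangent_bundle A) (tangent_bundle A) J \<and>
     (\<forall>e\<in>total (tangent_bundle A). J (J e) = vscale (tangent_bundle A) (- 1) e)"

definition nijenhuis_torsion ::
    "('m, 'n::finite) chart set \<Rightarrow> (('m, 'n) tvec \<Rightarrow> ('m, 'n) tvec)
      \<Rightarrow> ('m \<Rightarrow> ('m, 'n) tvec) \<Rightarrow> ('m \<Rightarrow> ('m, 'n) tvec) \<Rightarrow> 'm \<Rightarrow> ('m, 'n) tvec" where
  "nijenhuis_torsion A J X Y =
     (let T = tangent_bundle A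
      in sec_minus T
           (sec_minus T
              (sec_minus T (lie_bracket A (J \<circ> X) (J \<circ> Y)) (J \<circ> lie_bracket A (J \<circ> X) Y))
              (J \<circ> lie_bracket A X (J \<circ> Y)))
           (lie_bracket A X Y))"

definition complex_structure ::
    "('m, 'n::finite) chart set \<Rightarrow> (('m, 'n) tvec \<Rightarrow> ('m, 'n) tvec) \<Rightarrow> bool" where
  "complex_structure A J \<longleftrightarrow>
     almost_complex_structure A J \<and>
     (\<forall>X\<in>sections A (tangent_bundle A). \<forall>Y\<in>sections A (tangent_bundle A).
        nijenhuis_torsion A J X Y = vzero (tangent_bundle A))"

text \<open>\<open>p\<^sup>+ = \<onehalf> (Id - i J)\<close> on the complexified tangent bundle.\<close>

definition p_plus ::
    "('m, 'n::finite) chart set \<Rightarrow> (('m, 'n) tvec \<Rightarrow> ('m, 'n) tvec)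
      \<Rightarrow> ('m, 'n) ctvec \<Rightarrow> ('m, 'n) ctvec" where
  "p_plus A J e =
     (let T = ctangent_bundle A
      in vscale T (1 / 2) (vadd T e (vscale T (- \<i>) (complexify_end J e))))"


section \<open>Complex Lie algebroids\<close>

definition complex_lie_algebra_on ::
    "('m, 'n::finite) chart set \<Rightarrow> ('m, 'e, complex, 'r::finite) vbundle
      \<Rightarrow> (('m \<Rightarrow> 'e) \<Rightarrow> ('m \<Rightarrow> 'e) \<Rightarrow> 'm \<Rightarrow> 'e) \<Rightarrow> bool" where
  "complex_lie_algebra_on A E br \<longleftrightarrow>
     (let \<Gamma> = sections A E; add = sec_add E; scale = (\<lambda>a. sec_scale E (\<lambda>_. a)) in
       (\<forall>a\<in>\<Gamma>. \<forall>b\<in>\<Gamma>. br a b \<in> \<Gamma>) \<and>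
       (\<forall>a\<in>\<Gamma>. \<forall>b\<in>\<Gamma>. \<forall>c\<in>\<Gamma>. br (add a b) c = add (br a c) (br b c) \<and>
                             br a (add b c) = add (br a b) (br a c)) \<and>
       (\<forall>z. \<forall>a\<in>\<Gamma>. \<forall>b\<in>\<Gamma>. br (scale z a) b = scale z (br a b) \<and>
                         br a (scale z b) = scale z (br a b)) \<and>
       (\<forall>a\<in>\<Gamma>. br a a = vzero E) \<and>
       (\<forall>a\<in>\<Gamma>. \<forall>b\<in>\<Gamma>. \<forall>c\<in>\<Gamma>.
          add (add (br a (br b c)) (br b (br c a))) (br c (br a b)) = vzero E))"

definition complex_lie_algebroid ::
    "('m::topological_space, 'n::finite) chart set \<Rightarrow> ('m, 'e, complex, 'r::finite) vbundle
      \<Rightarrow> ('e \<Rightarrow> ('m, 'n) ctvec) \<Rightarrow> (('m \<Rightarrow> 'e) \<Rightarrow> ('m \<Rightarrow> 'e) \<Rightarrow> 'm \<Rightarrow> 'e) \<Rightarrow> bool" where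
  "complex_lie_algebroid A E q br \<longleftrightarrow>
     vector_bundle A E \<and>
     complex_lie_algebra_on A E br \<and>
     bundle_map A E (ctangent_bundle A) q \<and>
     (\<forall>a\<in>sections A E. \<forall>b\<in>sections A E. \<forall>f. mfd_smooth_on A UNIV f \<longrightarrow>
        br a (sec_scale E f b) =
        sec_add E (sec_scale E f (br a b)) (sec_scale E (cfield_act A (q \<circ> a) f) b))"

end

theory Submission
  imports Defs "HOL-Library.Function_Algebras"
begin

text \<open>
  An endomorphism \<open>N\<close> of a Lie algebra with \<open>[Nx, Ny] = N [x, y]\<^sub>N\<close> deforms the bracket into
  another Lie bracket \<open>[x, y]\<^sub>N\<close>: its Jacobi sum is a combination of Jacobi sums for the original
  bracket. For \<open>N = \<onehalf> (1 - i J)\<close> this condition is, up to a factor, the vanishing of the Nijenhuis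
  torsion of the complex linear extension of \<open>J\<close>. In the Leibniz rule for \<open>[Z, f W]\<^sub>N\<close> the two terms
  \<open>Z(f) N W\<close> cancel, so that \<open>N\<close> is the anchor. The Lie algebra of vector fields is handled in charts,
  where the Jacobi identity and the independence of the chart both come down to the symmetry of second
  derivatives.
\<close>

section \<open>Calculus of smooth maps on open sets\<close>

text \<open>The torsion of \<open>a + b J\<close> is \<open>b^2\<close> times that of
  \<open>J\<close>, so the factor between the torsions of \<open>N\<close> and \<open>J\<close> is
  -1/4. Integrability and the algebroid axioms both quantify over global sections, so the algebra
  takes place in one Lie ring of global fields and no local field ever has to be extended. Charts
  supply that ring, its Leibniz rule and the smoothness of \<open>J\<close> and
  \<open>p_plus\<close>. Two features of the encoding shape the rest. Tangent vectors carry base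
  points, so sections do not form a group type; complex fields are therefore handled as pairs of
  real fields without base points. And \<open>Ck_on\<close> controls derivatives in fixed directions
  only, while brackets differentiate along fields; expansion in \<open>Basis\<close> bridges this.
  The Jacobi argument needs additivity alone, so 1/2 enters it as an additive map commuting with
  \<open>J\<close> and the bracket, and complex scalars return only in the Leibniz rule and the
  final formula.\<close>

lemma frechet_derivative_eqI:
  "(f has_derivative f') (at x) \<Longrightarrow> frechet_derivative f (at x) = f'"
  by (rule frechet_derivative_at [symmetric])

text \<open>Coordinate expressions involve \<open>inv_into\<close> and are arbitrary outside the
  chart image. Equality on an open set is all that is available when they are compared, and it
  suffices because a derivative is local.\<close>

lemma frechet_derivative_cong_open:
  assumes "open S" "x \<in> S" "\<And>y. y \<in> S \<Longrightarrow> f y = g y"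
  shows "frechet_derivative f (at x) = frechet_derivative g (at x)"
proof -
  have "(f has_derivative f') (at x) \<longleftrightarrow> (g has_derivative f') (at x)" for f'
    using has_derivative_transform_within_open[of f f' x UNIV S g]
      has_derivative_transform_within_open[of g f' x UNIV S f] assms by auto
  then show ?thesis
    by (simp add: frechet_derivative_def)
qed

lemma differentiable_cong_open:
  assumes "open S" "x \<in> S" "\<And>y. y \<in> S \<Longrightarrow> f y = g y"
  shows "f differentiable (at x) \<longleftrightarrow> g differentiable (at x)"
  using has_derivative_transform_within_open[of f _ x UNIV S g]
      has_derivative_transform_within_open[of g _ x UNIV S f] assms
  unfolding differentiable_def by fastforce

text \<open>Turns a derivative in a varying direction into finitely many derivatives in fixed
  directions with varying coefficients, the form that \<open>Ck_on\<close> can handle.\<close>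

lemma linear_expand_Basis:
  fixes v :: "'a::euclidean_space"
  assumes "linear L"
  shows "L v = (\<Sum>b\<in>Basis. (v \<bullet> b) *\<^sub>R L b)"
proof -
  have "L v = L (\<Sum>b\<in>Basis. (v \<bullet> b) *\<^sub>R b)"
    by (simp add: euclidean_representation)
  also have "\<dots> = (\<Sum>b\<in>Basis. (v \<bullet> b) *\<^sub>R L b)"
    by (simp add: linear_sum[OF assms] linear_cmul[OF assms])
  finally show ?thesis .
qed

lemma Ck_on_cong:
  assumes "open S" "\<And>x. x \<in> S \<Longrightarrow> f x = g x" "Ck_on k S f"
  shows "Ck_on k S g"
  using assms(2,3)
proof (induction k arbitrary: f g)
  case 0
  then show ?case
    by (metis Ck_on.simps(1) continuous_on_cong)
next
  case (Suc k)
  have "g differentiable (at x)" if "x \<in> S" for x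
    using Suc.prems that differentiable_cong_open[OF assms(1) that, of f g] by simp
  moreover have "Ck_on k S (\<lambda>x. frechet_derivative g (at x) v)" for v
    by (rule Suc.IH[of "\<lambda>x. frechet_derivative f (at x) v"])
      (use Suc.prems in \<open>simp_all add: frechet_derivative_cong_open[OF assms(1), of _ f g]\<close>)
  ultimately show ?case by simp
qed

text \<open>The recursion for \<open>Ck_on (Suc k)\<close> speaks of derivatives only. Product and
  chain rules leave some factors undifferentiated, and these have to be lowered to order
  \<open>k\<close> before the induction hypothesis applies.\<close>

lemma Ck_on_SucD: "Ck_on (Suc k) S f \<Longrightarrow> Ck_on k S f"
proof (induction k arbitrary: f)
  case 0
  then show ?case
    by (simp add: continuous_at_imp_continuous_on differentiable_imp_continuous_within)
qed auto

lemma Ck_on_subset: "Ck_on k S f \<Longrightarrow> T \<subseteq> S \<Longrightarrow> Ck_on k T f"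
  by (induction k arbitrary: f) (auto intro: continuous_on_subset)

lemma Ck_on_const: "Ck_on k S (\<lambda>x. c)"
  by (induction k arbitrary: c) auto

lemma Ck_on_bounded_linear:
  assumes "open S" "bounded_linear h" "Ck_on k S f"
  shows "Ck_on k S (\<lambda>x. h (f x))"
  using assms(3)
proof (induction k arbitrary: f)
  case 0
  then show ?case
    using bounded_linear.continuous_on[OF assms(2)] by simp
next
  case (Suc k)
  have D: "((\<lambda>x. h (f x)) has_derivative (\<lambda>v. h (frechet_derivative f (at x) v))) (at x)" if "x \<in> S" for x
    using Suc.prems that by (intro bounded_linear.has_derivative[OF assms(2)])
      (auto simp: frechet_derivative_works[symmetric])
  have "Ck_on k S (\<lambda>x. frechet_derivative (\<lambda>x. h (f x)) (at x) v)" for v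
    by (rule Ck_on_cong[OF assms(1) _ Suc.IH[of "\<lambda>x. frechet_derivative f (at x) v"]])
      (use Suc.prems in \<open>auto simp: frechet_derivative_eqI[OF D]\<close>)
  then show ?case
    using D by (auto simp: differentiable_def)
qed

lemma Ck_on_add:
  assumes "open S" "Ck_on k S f" "Ck_on k S g"
  shows "Ck_on k S (\<lambda>x. f x + g x)"
  using assms(2,3)
proof (induction k arbitrary: f g)
  case 0
  then show ?case
    by (simp add: continuous_on_add)
next
  case (Suc k)
  have D: "((\<lambda>x. f x + g x) has_derivative
      (\<lambda>v. frechet_derivative f (at x) v + frechet_derivative g (at x) v)) (at x)" if "x \<in> S" for x
    using Suc.prems that by (intro has_derivative_add) (auto simp: frechet_derivative_works[symmetric])
  have "Ck_on k S (\<lambda>x. frechet_derivative (\<lambda>x. f x + g x) (at x) v)" for v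
    by (rule Ck_on_cong[OF assms(1) _ Suc.IH[of "\<lambda>x. frechet_derivative f (at x) v"
            "\<lambda>x. frechet_derivative g (at x) v"]])
      (use Suc.prems in \<open>auto simp: frechet_derivative_eqI[OF D]\<close>)
  then show ?case
    using D by (auto simp: differentiable_def)
qed

lemma Ck_on_sum:
  assumes "open S" "\<And>i. i \<in> I \<Longrightarrow> Ck_on k S (f i)"
  shows "Ck_on k S (\<lambda>x. \<Sum>i\<in>I. f i x)"
  using assms(2)
  by (induction I rule: infinite_finite_induct) (auto simp: Ck_on_const Ck_on_add assms(1))

lemma (in bounded_bilinear) Ck_on_prod:
  assumes "open S" "Ck_on k S f" "Ck_on k S g"
  shows "Ck_on k S (\<lambda>x. prod (f x) (g x))"
  using assms(2,3)
proof (induction k arbitrary: f g)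
  case 0
  then show ?case
    by (simp add: continuous_on)
next
  case (Suc k)
  have D: "((\<lambda>x. prod (f x) (g x)) has_derivative
      (\<lambda>v. prod (f x) (frechet_derivative g (at x) v) + prod (frechet_derivative f (at x) v) (g x))) (at x)"
      if "x \<in> S" for x
    using Suc.prems that by (intro FDERIV) (auto simp: frechet_derivative_works[symmetric])
  have "Ck_on k S (\<lambda>x. prod (f x) (frechet_derivative g (at x) v) + prod (frechet_derivative f (at x) v) (g x))" for v
    using Suc.prems Suc.prems[THEN Ck_on_SucD] by (intro Ck_on_add assms(1) Suc.IH) auto
  then have "Ck_on k S (\<lambda>x. frechet_derivative (\<lambda>x. prod (f x) (g x)) (at x) v)" for v
    by (rule Ck_on_cong[OF assms(1), rotated])
      (simp add: frechet_derivative_eqI[OF D])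
  then show ?case
    using D by (auto simp: differentiable_def)
qed

text \<open>The chain rule evaluates the derivative of \<open>g\<close> at a moving point on a
  moving vector. Expanded in \<open>Basis\<close> it is a sum of coefficients from \<open>f\<close>
  times directional derivatives of \<open>g\<close> composed with \<open>f\<close>. The latter are
  again compositions with the same inner map, so the induction varies \<open>g\<close> and keeps
  \<open>f\<close>.\<close>

lemma Ck_on_compose:
  fixes f :: "'a::euclidean_space \<Rightarrow> 'b::euclidean_space" and g :: "'b \<Rightarrow> 'c::real_normed_vector"
  assumes "open S" "f ` S \<subseteq> T" "Ck_on k S f" "Ck_on k T g"
  shows "Ck_on k S (\<lambda>x. g (f x))"
  using assms(3,4)
proof (induction k arbitrary: g)
  case 0
  then show ?case
    using assms(2) by (auto intro: continuous_on_compose2)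
next
  case (Suc k)
  have D: "((\<lambda>x. g (f x)) has_derivative
      (\<lambda>v. frechet_derivative g (at (f x)) (frechet_derivative f (at x) v))) (at x)" if "x \<in> S" for x
    using Suc.prems that assms(2)
    by (intro has_derivative_compose[of f _ x UNIV g]) (auto simp: frechet_derivative_works[symmetric])
  have eq: "frechet_derivative (\<lambda>x. g (f x)) (at x) v =
      (\<Sum>b\<in>Basis. (frechet_derivative f (at x) v \<bullet> b) *\<^sub>R frechet_derivative g (at (f x)) b)"
    if "x \<in> S" for x v
    using Suc.prems that assms(2)
    by (simp only: frechet_derivative_eqI[OF D])
      (intro linear_expand_Basis linear_frechet_derivative, auto)
  have "Ck_on k S (\<lambda>x. \<Sum>b\<in>Basis. (frechet_derivative f (at x) v \<bullet> b) *\<^sub>R frechet_derivative g (at (f x)) b)" for v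
    using Suc.prems Suc.prems(2)[THEN Ck_on_SucD]
    by (intro Ck_on_sum assms(1) bounded_bilinear.Ck_on_prod[OF bounded_bilinear_scaleR]
        Ck_on_bounded_linear[OF _ bounded_linear_inner_left] Suc.IH[of "\<lambda>y. frechet_derivative g (at y) b" for b])
      (auto intro: Ck_on_SucD[OF Suc.prems(1)])
  then have "Ck_on k S (\<lambda>x. frechet_derivative (\<lambda>x. g (f x)) (at x) v)" for v
    by (rule Ck_on_cong[OF assms(1), rotated]) (simp add: eq)
  then show ?case
    using D by (auto simp: differentiable_def)
qed

lemma smooth_on_cong:
  "open S \<Longrightarrow> (\<And>x. x \<in> S \<Longrightarrow> f x = g x) \<Longrightarrow> smooth_on S f \<Longrightarrow> smooth_on S g"
  unfolding smooth_on_def by (blast intro: Ck_on_cong)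

lemma smooth_on_subset: "smooth_on S f \<Longrightarrow> T \<subseteq> S \<Longrightarrow> smooth_on T f"
  unfolding smooth_on_def by (blast intro: Ck_on_subset)

lemma smooth_on_const: "smooth_on S (\<lambda>x. c)"
  by (simp add: smooth_on_def Ck_on_const)

lemma smooth_on_bounded_linear:
  "open S \<Longrightarrow> bounded_linear h \<Longrightarrow> smooth_on S f \<Longrightarrow> smooth_on S (\<lambda>x. h (f x))"
  by (simp add: smooth_on_def Ck_on_bounded_linear)

lemma smooth_on_add:
  "open S \<Longrightarrow> smooth_on S f \<Longrightarrow> smooth_on S g \<Longrightarrow> smooth_on S (\<lambda>x. f x + g x)"
  by (simp add: smooth_on_def Ck_on_add)

lemma smooth_on_uminus:
  "open S \<Longrightarrow> smooth_on S f \<Longrightarrow> smooth_on S (\<lambda>x. - f x)"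
  by (rule smooth_on_bounded_linear) (auto intro: bounded_linear_minus bounded_linear_ident)

lemma smooth_on_diff:
  "open S \<Longrightarrow> smooth_on S f \<Longrightarrow> smooth_on S g \<Longrightarrow> smooth_on S (\<lambda>x. f x - g x)"
  using smooth_on_add[of S f "\<lambda>x. - g x"] smooth_on_uminus[of S g] by simp

lemma smooth_on_sum:
  "open S \<Longrightarrow> (\<And>i. i \<in> I \<Longrightarrow> smooth_on S (f i)) \<Longrightarrow> smooth_on S (\<lambda>x. \<Sum>i\<in>I. f i x)"
  by (simp add: smooth_on_def Ck_on_sum)

lemma smooth_on_scaleR:
  "open S \<Longrightarrow> smooth_on S f \<Longrightarrow> smooth_on S g \<Longrightarrow> smooth_on S (\<lambda>x. f x *\<^sub>R g x)"
  by (simp add: smooth_on_def bounded_bilinear.Ck_on_prod[OF bounded_bilinear_scaleR])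

lemma smooth_on_compose:
  fixes f :: "'a::euclidean_space \<Rightarrow> 'b::euclidean_space" and g :: "'b \<Rightarrow> 'c::real_normed_vector"
  shows "open S \<Longrightarrow> f ` S \<subseteq> T \<Longrightarrow> smooth_on S f \<Longrightarrow> smooth_on T g \<Longrightarrow> smooth_on S (\<lambda>x. g (f x))"
  unfolding smooth_on_def by (blast intro: Ck_on_compose)

lemma smooth_on_differentiable: "smooth_on S f \<Longrightarrow> x \<in> S \<Longrightarrow> f differentiable (at x)"
  unfolding smooth_on_def using Ck_on.simps(2) by blast

lemma smooth_on_has_derivative:
  "smooth_on S f \<Longrightarrow> x \<in> S \<Longrightarrow> (f has_derivative frechet_derivative f (at x)) (at x)"
  using smooth_on_differentiable frechet_derivative_works by blast

lemma smooth_on_linear_derivative: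
  "smooth_on S f \<Longrightarrow> x \<in> S \<Longrightarrow> linear (frechet_derivative f (at x))"
  using smooth_on_differentiable linear_frechet_derivative by blast

lemma smooth_on_derivative_const:
  "smooth_on S f \<Longrightarrow> smooth_on S (\<lambda>x. frechet_derivative f (at x) v)"
  unfolding smooth_on_def using Ck_on.simps(2) by blast

lemma smooth_on_derivative:
  assumes "open S" "smooth_on S f" "smooth_on S g"
  shows "smooth_on S (\<lambda>x. frechet_derivative f (at x) (g x))"
proof (rule smooth_on_cong[OF assms(1)])
  show "smooth_on S (\<lambda>x. \<Sum>b\<in>Basis. (g x \<bullet> b) *\<^sub>R frechet_derivative f (at x) b)"
    using assms
    by (intro smooth_on_sum smooth_on_scaleR smooth_on_derivative_const
        smooth_on_bounded_linear[OF _ bounded_linear_inner_left])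
qed (metis assms(2) linear_expand_Basis smooth_on_linear_derivative)

section \<open>Second derivatives and their symmetry\<close>

lemma frechet_derivative_derivative_along:
  assumes "open S" "smooth_on S f" "smooth_on S g" "x \<in> S"
  shows "frechet_derivative (\<lambda>y. frechet_derivative f (at y) (g y)) (at x) u =
     frechet_derivative (\<lambda>y. frechet_derivative f (at y) (g x)) (at x) u
     + frechet_derivative f (at x) (frechet_derivative g (at x) u)"
proof -
  let ?Df = "\<lambda>y. frechet_derivative f (at y)"
  have eq: "frechet_derivative (\<lambda>y. ?Df y (h y)) (at x) =
      frechet_derivative (\<lambda>y. \<Sum>b\<in>Basis. (h y \<bullet> b) *\<^sub>R ?Df y b) (at x)" for h
    by (rule frechet_derivative_cong_open[OF assms(1,4)])
      (metis assms(2) linear_expand_Basis smooth_on_linear_derivative)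
  \<comment> \<open>Proved for every \<open>h\<close> because it is used twice: for
    \<open>h = g\<close>, and for the constant \<open>g x\<close>, where the terms with the
    derivative of \<open>h\<close> vanish. The two results differ by exactly the last summand of the
    claim.\<close>
  have D: "((\<lambda>y. \<Sum>b\<in>Basis. (h y \<bullet> b) *\<^sub>R ?Df y b) has_derivative
     (\<lambda>u. \<Sum>b\<in>Basis. (h x \<bullet> b) *\<^sub>R frechet_derivative (\<lambda>y. ?Df y b) (at x) u
        + (frechet_derivative h (at x) u \<bullet> b) *\<^sub>R ?Df x b)) (at x)" if "smooth_on S h" for h
    using assms that
    by (intro has_derivative_sum has_derivative_scaleR has_derivative_inner_left
        smooth_on_has_derivative[of S] smooth_on_derivative_const)
  have "?Df x (frechet_derivative g (at x) u) =
      (\<Sum>b\<in>Basis. (frechet_derivative g (at x) u \<bullet> b) *\<^sub>R ?Df x b)"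
    by (metis assms(2,4) linear_expand_Basis smooth_on_linear_derivative)
  then show ?thesis
    unfolding eq
    using frechet_derivative_eqI[OF D[OF assms(3)]] frechet_derivative_eqI[OF D[OF smooth_on_const[of S "g x"]]]
    by (simp add: sum.distrib)
qed

text \<open>The second difference over a parallelogram does not change when \<open>u\<close> and
  \<open>v\<close> are exchanged, but the mean value theorem, used once in each direction, expresses
  it by a mixed derivative in a definite order. Comparing both orders yields the symmetry.\<close>

lemma second_difference_mvt:
  fixes f :: "'a::euclidean_space \<Rightarrow> real"
  assumes "smooth_on S f" "h > 0"
    and in_S: "\<And>s t. 0 \<le> s \<Longrightarrow> s \<le> h \<Longrightarrow> 0 \<le> t \<Longrightarrow> t \<le> h \<Longrightarrow> x + s *\<^sub>R u + t *\<^sub>R v \<in> S"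
  obtains s t where "0 \<le> s" "s \<le> h" "0 \<le> t" "t \<le> h"
    "f (x + h *\<^sub>R u + h *\<^sub>R v) - f (x + h *\<^sub>R u) - f (x + h *\<^sub>R v) + f x =
      h * h * frechet_derivative (\<lambda>y. frechet_derivative f (at y) u) (at (x + s *\<^sub>R u + t *\<^sub>R v)) v"
proof -
  let ?Df = "\<lambda>y. frechet_derivative f (at y)"
  have 1: "((\<lambda>s. f (x + s *\<^sub>R u + t *\<^sub>R v)) has_derivative (\<lambda>r. ?Df (x + s *\<^sub>R u + t *\<^sub>R v) (r *\<^sub>R u)))
      (at s within {0..h})" if "0 \<le> s" "s \<le> h" "0 \<le> t" "t \<le> h" for s t
    using that
    by (intro has_derivative_compose[where f = "\<lambda>s. x + s *\<^sub>R u + t *\<^sub>R v" and g = f]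
        smooth_on_has_derivative[OF assms(1)] in_S) (auto intro!: derivative_eq_intros)
  \<comment> \<open>The mean value theorem for the difference between the opposite edges
    \<open>t = h\<close> and \<open>t = 0\<close> as a function of \<open>s\<close>. The terms
    \<open>0 *\<^sub>R v\<close> and \<open>h - 0\<close> let fact \<open>1\<close> apply to both
    edges literally.\<close>
  have "\<exists>s\<in>{0<..<h}. (f (x + h *\<^sub>R u + h *\<^sub>R v) - f (x + h *\<^sub>R u + 0 *\<^sub>R v))
      - (f (x + 0 *\<^sub>R u + h *\<^sub>R v) - f (x + 0 *\<^sub>R u + 0 *\<^sub>R v))
      = ?Df (x + s *\<^sub>R u + h *\<^sub>R v) ((h - 0) *\<^sub>R u) - ?Df (x + s *\<^sub>R u + 0 *\<^sub>R v) ((h - 0) *\<^sub>R u)"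
    using assms(2) by (intro mvt_simple has_derivative_diff 1) auto
  then obtain s where s: "0 < s" "s < h" and eq1: "f (x + h *\<^sub>R u + h *\<^sub>R v) - f (x + h *\<^sub>R u)
      - (f (x + h *\<^sub>R v) - f x)
      = ?Df (x + s *\<^sub>R u + h *\<^sub>R v) (h *\<^sub>R u) - ?Df (x + s *\<^sub>R u) (h *\<^sub>R u)"
    by auto
  have lin: "?Df (x + s *\<^sub>R u + t *\<^sub>R v) (h *\<^sub>R u) = h * ?Df (x + s *\<^sub>R u + t *\<^sub>R v) u" if "0 \<le> t" "t \<le> h" for t
    using linear_cmul[OF smooth_on_linear_derivative[OF assms(1) in_S]] that s by simp
  have 2: "((\<lambda>t. ?Df (x + s *\<^sub>R u + t *\<^sub>R v) u) has_derivative
      (\<lambda>r. frechet_derivative (\<lambda>y. ?Df y u) (at (x + s *\<^sub>R u + t *\<^sub>R v)) (r *\<^sub>R v)))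
      (at t within {0..h})" if "0 \<le> t" "t \<le> h" for t
    using that s
    by (intro has_derivative_compose[where f = "\<lambda>t. x + s *\<^sub>R u + t *\<^sub>R v" and g = "\<lambda>y. ?Df y u"]
        smooth_on_has_derivative[OF smooth_on_derivative_const[OF assms(1)]] in_S)
      (auto intro!: derivative_eq_intros)
  have "\<exists>t\<in>{0<..<h}. ?Df (x + s *\<^sub>R u + h *\<^sub>R v) u - ?Df (x + s *\<^sub>R u + 0 *\<^sub>R v) u
      = frechet_derivative (\<lambda>y. ?Df y u) (at (x + s *\<^sub>R u + t *\<^sub>R v)) ((h - 0) *\<^sub>R v)"
    using assms(2) by (intro mvt_simple 2) auto
  then obtain t where t: "0 < t" "t < h" and eq2: "?Df (x + s *\<^sub>R u + h *\<^sub>R v) u - ?Df (x + s *\<^sub>R u) u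
      = frechet_derivative (\<lambda>y. ?Df y u) (at (x + s *\<^sub>R u + t *\<^sub>R v)) (h *\<^sub>R v)"
    by auto
  have "frechet_derivative (\<lambda>y. ?Df y u) (at (x + s *\<^sub>R u + t *\<^sub>R v)) (h *\<^sub>R v)
      = h * frechet_derivative (\<lambda>y. ?Df y u) (at (x + s *\<^sub>R u + t *\<^sub>R v)) v"
    using linear_cmul[OF smooth_on_linear_derivative[OF smooth_on_derivative_const[OF assms(1)] in_S]] s t by simp
  then have "f (x + h *\<^sub>R u + h *\<^sub>R v) - f (x + h *\<^sub>R u) - f (x + h *\<^sub>R v) + f x =
      h * h * frechet_derivative (\<lambda>y. ?Df y u) (at (x + s *\<^sub>R u + t *\<^sub>R v)) v"
    using eq1 eq2 lin[of h] lin[of 0] assms(2) by (simp add: algebra_simps)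
  then show ?thesis
    using that s t by (meson less_imp_le)
qed

lemma second_derivative_symmetric_real:
  fixes f :: "'a::euclidean_space \<Rightarrow> real"
  assumes S: "open S" "smooth_on S f" "x \<in> S"
  shows "frechet_derivative (\<lambda>y. frechet_derivative f (at y) u) (at x) v =
    frechet_derivative (\<lambda>y. frechet_derivative f (at y) v) (at x) u"
proof -
  define D where "D = (\<lambda>u v y. frechet_derivative (\<lambda>y. frechet_derivative f (at y) u) (at y) v)"
  have cont: "continuous (at x) (D u v)" for u v
    using smooth_on_derivative_const[OF smooth_on_derivative_const[OF assms(2)]] assms
    unfolding D_def by (intro differentiable_imp_continuous_within smooth_on_differentiable[of S]) auto
  have "\<bar>D u v x - D v u x\<bar> \<le> e" if "e > 0" for e
  proof -
    have e: "e / 2 > 0" using that by simp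
    obtain d1 where d1: "d1 > 0" "\<And>y. dist y x < d1 \<Longrightarrow> dist (D u v y) (D u v x) < e / 2"
      using cont[of u v] e unfolding continuous_at_eps_delta dist_real_def by metis
    obtain d2 where d2: "d2 > 0" "\<And>y. dist y x < d2 \<Longrightarrow> dist (D v u y) (D v u x) < e / 2"
      using cont[of v u] e unfolding continuous_at_eps_delta dist_real_def by metis
    obtain d3 where d3: "d3 > 0" "ball x d3 \<subseteq> S"
      using assms open_contains_ball by blast
    define d where "d = min d1 (min d2 d3)"
    \<comment> \<open>The points of the parallelogram with sides \<open>h u\<close> and
      \<open>h v\<close> lie within \<open>h * N = d / 2\<close> of \<open>x\<close>. The summand 1
      keeps \<open>N\<close> positive when \<open>u\<close> and \<open>v\<close> both
      vanish.\<close>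
    define N where "N = norm u + norm v + 1"
    define h where "h = d / (2 * N)"
    have n: "N > 0" by (simp add: N_def add_nonneg_pos)
    have d: "d > 0" using d1 d2 d3 by (simp add: d_def)
    have h: "h > 0" using n d by (simp add: h_def)
    have near: "norm (s *\<^sub>R u + t *\<^sub>R v) < d" if "0 \<le> s" "s \<le> h" "0 \<le> t" "t \<le> h" for s t
    proof -
      have "norm (s *\<^sub>R u + t *\<^sub>R v) \<le> s * norm u + t * norm v"
        using that norm_triangle_ineq[of "s *\<^sub>R u" "t *\<^sub>R v"] by simp
      also have "\<dots> \<le> h * norm u + h * norm v"
        using that by (intro add_mono mult_right_mono) auto
      also have "\<dots> \<le> h * N"
        using h by (simp add: N_def algebra_simps)
      also have "\<dots> = d / 2"
        using n by (simp add: h_def)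
      finally show ?thesis using d by simp
    qed
    have dist: "dist (x + s *\<^sub>R u + t *\<^sub>R v) x < d" "dist (x + t *\<^sub>R v + s *\<^sub>R u) x < d"
      if "0 \<le> s" "s \<le> h" "0 \<le> t" "t \<le> h" for s t
      using near[OF that] by (auto simp: dist_norm algebra_simps)
    have inS: "x + s *\<^sub>R u + t *\<^sub>R v \<in> S" "x + t *\<^sub>R v + s *\<^sub>R u \<in> S"
      if "0 \<le> s" "s \<le> h" "0 \<le> t" "t \<le> h" for s t
      using dist[OF that] d3(2) unfolding d_def by (auto simp: dist_commute)
    obtain s t where st: "0 \<le> s" "s \<le> h" "0 \<le> t" "t \<le> h"
      "f (x + h *\<^sub>R u + h *\<^sub>R v) - f (x + h *\<^sub>R u) - f (x + h *\<^sub>R v) + f x = h * h * D u v (x + s *\<^sub>R u + t *\<^sub>R v)"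
      using second_difference_mvt[OF assms(2) h, of x u v] inS unfolding D_def by metis
    obtain s' t' where st': "0 \<le> s'" "s' \<le> h" "0 \<le> t'" "t' \<le> h"
      "f (x + h *\<^sub>R v + h *\<^sub>R u) - f (x + h *\<^sub>R v) - f (x + h *\<^sub>R u) + f x = h * h * D v u (x + t' *\<^sub>R v + s' *\<^sub>R u)"
      using second_difference_mvt[OF assms(2) h, of x v u] inS unfolding D_def by metis
    \<comment> \<open>Both orders give the same second difference, so the two mixed derivatives
      agree at two points near \<open>x\<close>, each within \<open>e / 2\<close> of its value at
      \<open>x\<close>.\<close>
    have "x + h *\<^sub>R v + h *\<^sub>R u = x + h *\<^sub>R u + h *\<^sub>R v" by simp
    then have "h * h * D u v (x + s *\<^sub>R u + t *\<^sub>R v) = h * h * D v u (x + t' *\<^sub>R v + s' *\<^sub>R u)"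
      using st(5) st'(5) by (simp only:)
    then have "D u v (x + s *\<^sub>R u + t *\<^sub>R v) = D v u (x + t' *\<^sub>R v + s' *\<^sub>R u)"
      using h mult_left_cancel[of "h * h"] by simp
    moreover have "dist (D u v (x + s *\<^sub>R u + t *\<^sub>R v)) (D u v x) < e / 2"
      using dist(1)[OF st(1-4)] by (intro d1) (simp add: d_def)
    moreover have "dist (D v u (x + t' *\<^sub>R v + s' *\<^sub>R u)) (D v u x) < e / 2"
      using dist(2)[OF st'(1-4)] by (intro d2) (simp add: d_def)
    ultimately show ?thesis
      unfolding dist_real_def by linarith
  qed
  then have "\<bar>D u v x - D v u x\<bar> \<le> 0"
    by (rule field_le_epsilon) simp
  then show ?thesis
    by (simp add: D_def)
qed

text \<open>The mean value theorem is confined to real values, so the vector-valued case is tested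
  against every \<open>w\<close> by the inner product, which commutes with differentiation.\<close>

lemma second_derivative_symmetric:
  fixes f :: "'a::euclidean_space \<Rightarrow> 'b::real_inner"
  assumes S: "open S" "smooth_on S f" "x \<in> S"
  shows "frechet_derivative (\<lambda>y. frechet_derivative f (at y) u) (at x) v =
    frechet_derivative (\<lambda>y. frechet_derivative f (at y) v) (at x) u"
proof -
  have inner: "frechet_derivative (\<lambda>y. g y \<bullet> w) (at y) z = frechet_derivative g (at y) z \<bullet> w"
    if "smooth_on S g" "y \<in> S" for g :: "'a \<Rightarrow> 'b" and w y z
    by (subst frechet_derivative_eqI[OF has_derivative_inner_left[OF smooth_on_has_derivative[OF that]]]) simp
  have "frechet_derivative (\<lambda>y. frechet_derivative f (at y) u) (at x) v \<bullet> w
     = frechet_derivative (\<lambda>y. frechet_derivative (\<lambda>y. f y \<bullet> w) (at y) u) (at x) v" for u v w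
  proof -
    have "frechet_derivative (\<lambda>y. frechet_derivative (\<lambda>y. f y \<bullet> w) (at y) u) (at x)
       = frechet_derivative (\<lambda>y. frechet_derivative f (at y) u \<bullet> w) (at x)"
      by (rule frechet_derivative_cong_open[OF S(1,3)]) (simp add: inner S)
    then show ?thesis
      using inner[OF smooth_on_derivative_const[OF S(2)] S(3)] by simp
  qed
  moreover have "smooth_on S (\<lambda>y. f y \<bullet> w)" for w
    using S(1,2) by (intro smooth_on_bounded_linear[OF _ bounded_linear_inner_left])
  ultimately have "frechet_derivative (\<lambda>y. frechet_derivative f (at y) u) (at x) v \<bullet> w
     = frechet_derivative (\<lambda>y. frechet_derivative f (at y) v) (at x) u \<bullet> w" for w
    using second_derivative_symmetric_real[OF S(1) _ S(3)] by metis
  then show ?thesis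
    using vector_eq_rdot by blast
qed

lemma frechet_derivative_chain:
  assumes "smooth_on S f" "x \<in> S" "smooth_on T g" "f x \<in> T"
  shows "frechet_derivative (\<lambda>x. g (f x)) (at x) v =
    frechet_derivative g (at (f x)) (frechet_derivative f (at x) v)"
  using frechet_derivative_eqI[OF has_derivative_compose[where f = f and g = g,
        OF smooth_on_has_derivative[OF assms(1,2)] smooth_on_has_derivative[OF assms(3,4)]]]
  by simp

section \<open>The Lie bracket in coordinates\<close>

definition coord_bracket :: "('a \<Rightarrow> 'a) \<Rightarrow> ('a \<Rightarrow> 'a) \<Rightarrow> 'a::real_normed_vector \<Rightarrow> 'a" where
  "coord_bracket F G x = frechet_derivative G (at x) (F x) - frechet_derivative F (at x) (G x)"

lemma smooth_on_coord_bracket: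
  fixes F G :: "'a::euclidean_space \<Rightarrow> 'a"
  shows "open S \<Longrightarrow> smooth_on S F \<Longrightarrow> smooth_on S G \<Longrightarrow> smooth_on S (coord_bracket F G)"
  unfolding coord_bracket_def by (intro smooth_on_diff smooth_on_derivative)

lemma coord_bracket_cong:
  assumes "open S" "x \<in> S" "\<And>y. y \<in> S \<Longrightarrow> F y = F' y" "\<And>y. y \<in> S \<Longrightarrow> G y = G' y"
  shows "coord_bracket F G x = coord_bracket F' G' x"
  using frechet_derivative_cong_open[OF assms(1,2), of F F']
    frechet_derivative_cong_open[OF assms(1,2), of G G'] assms
  by (simp add: coord_bracket_def)

lemma coord_bracket_add_left:
  fixes F :: "'a::euclidean_space \<Rightarrow> 'a"
  assumes "smooth_on S F" "smooth_on S F'" "smooth_on S G" "x \<in> S"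
  shows "coord_bracket (\<lambda>x. F x + F' x) G x = coord_bracket F G x + coord_bracket F' G x"
  using frechet_derivative_eqI[OF has_derivative_add[OF smooth_on_has_derivative[OF assms(1,4)]
        smooth_on_has_derivative[OF assms(2,4)]]]
  by (simp add: coord_bracket_def linear_add[OF smooth_on_linear_derivative[OF assms(3,4)]])

lemma coord_bracket_scaleR_right:
  fixes F :: "'a::euclidean_space \<Rightarrow> 'a"
  assumes "smooth_on S F" "smooth_on S G" "smooth_on S g" "x \<in> S"
  shows "coord_bracket F (\<lambda>x. g x *\<^sub>R G x) x =
    g x *\<^sub>R coord_bracket F G x + frechet_derivative g (at x) (F x) *\<^sub>R G x"
  using frechet_derivative_eqI[OF has_derivative_scaleR[OF smooth_on_has_derivative[OF assms(3,4)]
        smooth_on_has_derivative[OF assms(2,4)]]]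
  by (simp add: coord_bracket_def linear_cmul[OF smooth_on_linear_derivative[OF assms(1,4)]] algebra_simps)

text \<open>The two second derivatives of \<open>T\<close> cancel by symmetry.\<close>

lemma coord_bracket_related:
  fixes T :: "'a::euclidean_space \<Rightarrow> 'b::euclidean_space"
  assumes S: "open S" "x \<in> S" "smooth_on S T" "smooth_on S F" "smooth_on S G"
    and S': "smooth_on S' F'" "smooth_on S' G'" "T ` S \<subseteq> S'"
    and F: "\<And>y. y \<in> S \<Longrightarrow> F' (T y) = frechet_derivative T (at y) (F y)"
    and G: "\<And>y. y \<in> S \<Longrightarrow> G' (T y) = frechet_derivative T (at y) (G y)"
  shows "coord_bracket F' G' (T x) = frechet_derivative T (at x) (coord_bracket F G x)"
proof -
  have D: "frechet_derivative H' (at (T x)) (frechet_derivative T (at x) u) =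
      frechet_derivative (\<lambda>y. frechet_derivative T (at y) (H x)) (at x) u
      + frechet_derivative T (at x) (frechet_derivative H (at x) u)"
    if H: "smooth_on S H" "smooth_on S' H'" "\<And>y. y \<in> S \<Longrightarrow> H' (T y) = frechet_derivative T (at y) (H y)"
    for H H' u
  proof -
    have "frechet_derivative H' (at (T x)) (frechet_derivative T (at x) u) =
        frechet_derivative (\<lambda>y. H' (T y)) (at x) u"
      using frechet_derivative_chain[OF S(3,2) H(2)] S S'(3) by auto
    also have "\<dots> = frechet_derivative (\<lambda>y. frechet_derivative T (at y) (H y)) (at x) u"
      using frechet_derivative_cong_open[OF S(1,2) H(3)] by simp
    finally show ?thesis
      using frechet_derivative_derivative_along[OF S(1,3) H(1) S(2)] by simp
  qed
  show ?thesis
    using D[OF S(4) S'(1), of "G x"] D[OF S(5) S'(2), of "F x"] F G S(2)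
      second_derivative_symmetric[OF S(1,3,2), of "G x" "F x"]
    by (simp add: coord_bracket_def linear_diff[OF smooth_on_linear_derivative[OF S(3,2)]])
qed

text \<open>In the expanded cyclic sum each field carries two second derivatives of opposite sign
  with exchanged arguments, which cancel by symmetry. The compositions of first derivatives cancel
  literally.\<close>

lemma coord_bracket_jacobi:
  fixes F G H :: "'a::euclidean_space \<Rightarrow> 'a"
  assumes S: "open S" "x \<in> S" and "smooth_on S F" "smooth_on S G" "smooth_on S H"
  shows "coord_bracket F (coord_bracket G H) x + coord_bracket G (coord_bracket H F) x
    + coord_bracket H (coord_bracket F G) x = 0"
proof -
  let ?D = "\<lambda>F. frechet_derivative F (at x)"
  let ?DD = "\<lambda>F u v. frechet_derivative (\<lambda>y. frechet_derivative F (at y) v) (at x) u"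
  have expand: "coord_bracket F (coord_bracket G H) x =
      ?DD H (F x) (G x) + ?D H (?D G (F x)) - ?DD G (F x) (H x) - ?D G (?D H (F x))
      - ?D F (?D H (G x)) + ?D F (?D G (H x))"
    if F: "smooth_on S F" and G: "smooth_on S G" and H: "smooth_on S H" for F G H :: "'a \<Rightarrow> 'a"
  proof -
    have "((\<lambda>y. frechet_derivative H (at y) (G y) - frechet_derivative G (at y) (H y)) has_derivative
      (\<lambda>u. ?D (\<lambda>y. frechet_derivative H (at y) (G y)) u - ?D (\<lambda>y. frechet_derivative G (at y) (H y)) u)) (at x)"
      by (intro has_derivative_diff smooth_on_has_derivative[OF _ S(2)] smooth_on_derivative S F G H)
    from frechet_derivative_eqI[OF this]
    have "?D (coord_bracket G H) u = ?DD H u (G x) + ?D H (?D G u) - (?DD G u (H x) + ?D G (?D H u))" for u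
      unfolding coord_bracket_def[abs_def]
      by (simp add: frechet_derivative_derivative_along[OF S(1) H G S(2)]
          frechet_derivative_derivative_along[OF S(1) G H S(2)])
    then show ?thesis
      unfolding coord_bracket_def[of F]
      by (simp add: coord_bracket_def[of G H] linear_diff[OF smooth_on_linear_derivative[OF F S(2)]])
  qed
  have sym: "?DD F u v = ?DD F v u" if "smooth_on S F" for F :: "'a \<Rightarrow> 'a" and u v
    using second_derivative_symmetric[OF S(1) that S(2)] .
  show ?thesis
    using assms sym[of F "G x" "H x"] sym[of G "H x" "F x"] sym[of H "F x" "G x"]
    by (simp add: expand)
qed

section \<open>Lie rings and contracted brackets\<close>

definition contraction :: "('v \<Rightarrow> 'v \<Rightarrow> 'v::ab_group_add) \<Rightarrow> ('v \<Rightarrow> 'v) \<Rightarrow> 'v \<Rightarrow> 'v \<Rightarrow> 'v" where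
  "contraction br N x y = br (N x) y + br x (N y) - N (br x y)"

text \<open>The carrier \<open>S\<close> is explicit because the bracket of fields behaves well only
  on smooth ones. Additivity is listed on the left and carried to the right by
  \<open>br_antisym\<close>; \<open>br_self\<close> is a separate axiom since \<open>x = - x\<close>
  does not force \<open>x = 0\<close> in a general abelian group.\<close>

locale lie_ring_on =
  fixes S :: "'v::ab_group_add set" and br :: "'v \<Rightarrow> 'v \<Rightarrow> 'v"
  assumes zero_closed [simp]: "0 \<in> S"
    and add_closed [simp]: "x \<in> S \<Longrightarrow> y \<in> S \<Longrightarrow> x + y \<in> S"
    and minus_closed [simp]: "x \<in> S \<Longrightarrow> - x \<in> S"
    and br_closed [simp]: "x \<in> S \<Longrightarrow> y \<in> S \<Longrightarrow> br x y \<in> S"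
    and br_add_left: "x \<in> S \<Longrightarrow> y \<in> S \<Longrightarrow> z \<in> S \<Longrightarrow> br (x + y) z = br x z + br y z"
    and br_self: "x \<in> S \<Longrightarrow> br x x = 0"
    and br_antisym: "x \<in> S \<Longrightarrow> y \<in> S \<Longrightarrow> br x y = - br y x"
    and jacobi: "x \<in> S \<Longrightarrow> y \<in> S \<Longrightarrow> z \<in> S \<Longrightarrow>
      br x (br y z) + br y (br z x) + br z (br x y) = 0"
begin

lemma diff_closed [simp]: "x \<in> S \<Longrightarrow> y \<in> S \<Longrightarrow> x - y \<in> S"
  using add_closed[of x "- y"] by simp

lemma br_add_right: "x \<in> S \<Longrightarrow> y \<in> S \<Longrightarrow> z \<in> S \<Longrightarrow> br x (y + z) = br x y + br x z"
  using br_antisym[of x "y + z"] br_antisym[of x y] br_antisym[of x z] br_add_left[of y z x] by simp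

lemma br_zero_left: "y \<in> S \<Longrightarrow> br 0 y = 0"
  using br_add_left[of 0 0 y] by simp

lemma br_minus_left: "x \<in> S \<Longrightarrow> y \<in> S \<Longrightarrow> br (- x) y = - br x y"
  using br_add_left[of x "- x" y] br_zero_left[of y] by (simp add: eq_neg_iff_add_eq_0 add.commute)

lemma br_minus_right: "x \<in> S \<Longrightarrow> y \<in> S \<Longrightarrow> br x (- y) = - br x y"
  by (metis br_antisym br_minus_left minus_closed)

lemma br_diff_left: "x \<in> S \<Longrightarrow> y \<in> S \<Longrightarrow> z \<in> S \<Longrightarrow> br (x - y) z = br x z - br y z"
  using br_add_left[of x "- y" z] br_minus_left by simp

lemma br_diff_right: "x \<in> S \<Longrightarrow> y \<in> S \<Longrightarrow> z \<in> S \<Longrightarrow> br x (y - z) = br x y - br x z"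
  using br_add_right[of x y "- z"] br_minus_right by simp

lemmas br_simps = br_add_left br_add_right br_minus_left br_minus_right br_diff_left br_diff_right

end

locale lie_ring_endo = lie_ring_on +
  fixes N :: "'v::ab_group_add \<Rightarrow> 'v"
  assumes N_closed [simp]: "x \<in> S \<Longrightarrow> N x \<in> S"
    and N_add: "x \<in> S \<Longrightarrow> y \<in> S \<Longrightarrow> N (x + y) = N x + N y"
begin

lemma N_zero: "N 0 = 0"
  using N_add[of 0 0] by simp

lemma N_minus: "x \<in> S \<Longrightarrow> N (- x) = - N x"
  using N_add[of x "- x"] N_zero by (simp add: eq_neg_iff_add_eq_0 add.commute)

lemma N_diff: "x \<in> S \<Longrightarrow> y \<in> S \<Longrightarrow> N (x - y) = N x - N y"
  using N_add[of x "- y"] N_minus by simp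

lemmas N_simps = N_add N_minus N_diff

lemma contraction_closed [simp]: "x \<in> S \<Longrightarrow> y \<in> S \<Longrightarrow> contraction br N x y \<in> S"
  by (simp add: contraction_def)

lemma contraction_self: "x \<in> S \<Longrightarrow> contraction br N x x = 0"
  using br_antisym[of x "N x"] by (simp add: contraction_def br_self N_zero)

lemma contraction_antisym: "x \<in> S \<Longrightarrow> y \<in> S \<Longrightarrow> contraction br N x y = - contraction br N y x"
  using br_antisym[of x "N y"] br_antisym[of "N x" y] br_antisym[of x y]
  by (simp add: contraction_def N_minus)

lemma contraction_add_left:
  "x \<in> S \<Longrightarrow> y \<in> S \<Longrightarrow> z \<in> S \<Longrightarrow>
    contraction br N (x + y) z = contraction br N x z + contraction br N y z"
  by (simp add: contraction_def br_simps N_simps)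

lemma contraction_add_right:
  "x \<in> S \<Longrightarrow> y \<in> S \<Longrightarrow> z \<in> S \<Longrightarrow>
    contraction br N x (y + z) = contraction br N x y + contraction br N x z"
  by (simp add: contraction_def br_simps N_simps)

text \<open>Torsion-freeness, applied to \<open>(x, y)\<close> and to \<open>(x, [y, z])\<close>, writes the cyclic sum
  as three cyclic sums for \<open>br\<close>, to which \<open>1\<close>, \<open>- N\<close> and \<open>N\<^sup>2\<close> are applied.\<close>

lemma contraction_jacobi:
  assumes torsion_free: "\<And>x y. x \<in> S \<Longrightarrow> y \<in> S \<Longrightarrow> br (N x) (N y) = N (contraction br N x y)"
    and S: "x \<in> S" "y \<in> S" "z \<in> S"
  shows "contraction br N x (contraction br N y z) + contraction br N y (contraction br N z x)
    + contraction br N z (contraction br N x y) = 0"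
proof -
  have expand: "contraction br N x (contraction br N y z) =
      br (N x) (br (N y) z) + br (N x) (br y (N z)) + br x (br (N y) (N z))
      - N (br x (br (N y) z) + br x (br y (N z)) + br (N x) (br y z)) + N (N (br x (br y z)))"
    if "x \<in> S" "y \<in> S" "z \<in> S" for x y z
  proof -
    have "contraction br N x (contraction br N y z) =
      br (N x) (br (N y) z) + br (N x) (br y (N z)) - br (N x) (N (br y z)) + br x (br (N y) (N z))
      - N (br x (br (N y) z) + br x (br y (N z)) - br x (N (br y z)))"
      using torsion_free[of y z] that
      unfolding contraction_def[of br N x "contraction br N y z"]
      by (simp add: contraction_def br_simps N_simps)
    moreover have "br (N x) (N (br y z)) = N (br (N x) (br y z)) + N (br x (N (br y z))) - N (N (br x (br y z)))"
      using torsion_free[of x "br y z"] that by (simp add: contraction_def N_simps)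
    ultimately show ?thesis
      using that by (simp add: N_simps algebra_simps)
  qed
  have "contraction br N x (contraction br N y z) + contraction br N y (contraction br N z x)
      + contraction br N z (contraction br N x y) =
      (br (N x) (br (N y) z) + br (N y) (br z (N x)) + br z (br (N x) (N y)))
      + (br (N x) (br y (N z)) + br y (br (N z) (N x)) + br (N z) (br (N x) y))
      + (br x (br (N y) (N z)) + br (N y) (br (N z) x) + br (N z) (br x (N y)))
      - (N (br (N x) (br y z) + br y (br z (N x)) + br z (br (N x) y))
        + N (br x (br (N y) z) + br (N y) (br z x) + br z (br x (N y)))
        + N (br x (br y (N z)) + br y (br (N z) x) + br (N z) (br x y)))
      + N (N (br x (br y z) + br y (br z x) + br z (br x y)))"
    unfolding expand[OF S] expand[OF S(2,3,1)] expand[OF S(3,1,2)]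
    using S by (simp add: N_simps algebra_simps)
  also have "\<dots> = 0"
    using S by (simp only: jacobi N_closed N_zero) simp
  finally show ?thesis .
qed

end

subsection \<open>Complexification\<close>

definition complexify_br :: "('v \<Rightarrow> 'v \<Rightarrow> 'v::ab_group_add) \<Rightarrow> 'v \<times> 'v \<Rightarrow> 'v \<times> 'v \<Rightarrow> 'v \<times> 'v" where
  "complexify_br br z w =
     (br (fst z) (fst w) - br (snd z) (snd w), br (fst z) (snd w) + br (snd z) (fst w))"

context lie_ring_on
begin

text \<open>These are the real and imaginary parts of the Jacobi sum of \<open>x + i x'\<close>,
  \<open>y + i y'\<close>, \<open>z + i z'\<close>. Multilinearity splits it into eight real Jacobi
  sums: those with an even number of primes form the real part, those with an odd number the
  imaginary part, with the sign of the corresponding power of i.\<close>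

lemma complexify_br_jacobi:
  assumes "x \<in> S" "x' \<in> S" "y \<in> S" "y' \<in> S" "z \<in> S" "z' \<in> S"
  shows "br x (br y z - br y' z') - br x' (br y z' + br y' z)
     + (br y (br z x - br z' x') - br y' (br z x' + br z' x))
     + (br z (br x y - br x' y') - br z' (br x y' + br x' y)) = 0"
    and "br x (br y z' + br y' z) + br x' (br y z - br y' z')
     + (br y (br z x' + br z' x) + br y' (br z x - br z' x'))
     + (br z (br x y' + br x' y) + br z' (br x y - br x' y')) = 0"
proof -
  let ?J = "\<lambda>x y z. br x (br y z) + br y (br z x) + br z (br x y)"
  have "br x (br y z - br y' z') - br x' (br y z' + br y' z)
     + (br y (br z x - br z' x') - br y' (br z x' + br z' x))
     + (br z (br x y - br x' y') - br z' (br x y' + br x' y))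
     = ?J x y z - ?J x y' z' - ?J x' y z' - ?J x' y' z"
    using assms by (simp add: br_simps algebra_simps)
  also have "\<dots> = 0"
    using assms by (simp only: jacobi) simp
  finally show "br x (br y z - br y' z') - br x' (br y z' + br y' z)
     + (br y (br z x - br z' x') - br y' (br z x' + br z' x))
     + (br z (br x y - br x' y') - br z' (br x y' + br x' y)) = 0" .
  have "br x (br y z' + br y' z) + br x' (br y z - br y' z')
     + (br y (br z x' + br z' x) + br y' (br z x - br z' x'))
     + (br z (br x y' + br x' y) + br z' (br x y - br x' y'))
     = ?J x y z' + ?J x y' z + ?J x' y z - ?J x' y' z'"
    using assms by (simp add: br_simps algebra_simps)
  also have "\<dots> = 0"
    using assms by (simp only: jacobi) simp
  finally show "br x (br y z' + br y' z) + br x' (br y z - br y' z')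
     + (br y (br z x' + br z' x) + br y' (br z x - br z' x'))
     + (br z (br x y' + br x' y) + br z' (br x y - br x' y')) = 0" .
qed

lemma complexify_lie_ring: "lie_ring_on (S \<times> S) (complexify_br br)"
proof
  fix z w v :: "'v \<times> 'v"
  assume S: "z \<in> S \<times> S" "w \<in> S \<times> S"
  show "complexify_br br z w = - complexify_br br w z"
    using S br_antisym[of "fst z" "fst w"] br_antisym[of "snd z" "snd w"]
      br_antisym[of "fst z" "snd w"] br_antisym[of "snd z" "fst w"]
    by (auto simp: complexify_br_def)
  assume v: "v \<in> S \<times> S"
  show "complexify_br br (z + w) v = complexify_br br z v + complexify_br br w v"
    using S v by (auto simp: complexify_br_def br_simps)
  show "complexify_br br z (complexify_br br w v) + complexify_br br w (complexify_br br v z)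
      + complexify_br br v (complexify_br br z w) = 0"
    using S v complexify_br_jacobi[of "fst z" "snd z" "fst w" "snd w" "fst v" "snd v"]
    by (simp add: complexify_br_def mem_Times_iff zero_prod_def)
next
  fix z assume "z \<in> S \<times> S"
  then show "complexify_br br z z = 0"
    using br_antisym[of "fst z" "snd z"] by (auto simp: complexify_br_def br_self zero_prod_def)
qed (auto simp: complexify_br_def zero_prod_def)

end

text \<open>Below, \<open>half\<close> is multiplication by \<open>1/2\<close>, and \<open>half_plus\<close> is then \<open>\<onehalf> (1 - i J)\<close> on
  \<open>(x, y) = x + i y\<close>.\<close>

locale complex_lie_ring = lie_ring_endo S br J
  for S :: "'v::ab_group_add set" and br J +
  fixes half :: "'v \<Rightarrow> 'v"
  assumes J_square: "x \<in> S \<Longrightarrow> J (J x) = - x"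
    and J_torsion: "x \<in> S \<Longrightarrow> y \<in> S \<Longrightarrow> br (J x) (J y) = J (br (J x) y) + J (br x (J y)) + br x y"
    and half_closed [simp]: "x \<in> S \<Longrightarrow> half x \<in> S"
    and half_add: "half (x + y) = half x + half y"
    and half_J: "x \<in> S \<Longrightarrow> J (half x) = half (J x)"
    and half_br: "x \<in> S \<Longrightarrow> y \<in> S \<Longrightarrow> br (half x) y = half (br x y)"
begin

definition half_plus :: "'v \<times> 'v \<Rightarrow> 'v \<times> 'v" where
  "half_plus z = (half (fst z + J (snd z)), half (snd z - J (fst z)))"

lemma half_zero: "half 0 = 0"
  using half_add[of 0 0] by simp

lemma half_minus: "half (- x) = - half x"
  using half_add[of x "- x"] half_zero by (simp add: eq_neg_iff_add_eq_0 add.commute)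

lemma half_diff: "half (x - y) = half x - half y"
  using half_add[of x "- y"] half_minus by simp

lemma half_br_right: "x \<in> S \<Longrightarrow> y \<in> S \<Longrightarrow> br x (half y) = half (br x y)"
  using br_antisym[of x "half y"] br_antisym[of x y] half_br[of y x] by (simp add: half_minus)

lemma half_plus_endo: "lie_ring_endo (S \<times> S) (complexify_br br) half_plus"
  by (intro lie_ring_endo.intro complexify_lie_ring lie_ring_endo_axioms.intro)
    (auto simp: half_plus_def N_simps half_add half_diff)

text \<open>The factor 1/2 is split off as \<open>h\<close>, leaving \<open>M = 1 - i J\<close>. As
  \<open>h\<close> commutes with \<open>M\<close> and with the bracket in either argument, both
  sides equal \<open>h (h ...)\<close> of the corresponding expression for \<open>M\<close>. There
  the difference of the two sides is minus the torsion of \<open>J\<close>, so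
  \<open>J_torsion\<close> and \<open>J_square\<close> settle each component.\<close>

lemma half_plus_torsion_free:
  assumes "z \<in> S \<times> S" "w \<in> S \<times> S"
  shows "complexify_br br (half_plus z) (half_plus w) =
    half_plus (contraction (complexify_br br) half_plus z w)"
proof -
  define h where "h z = (half (fst z), half (snd z))" for z
  define M where "M z = (fst z + J (snd z), snd z - J (fst z))" for z
  have M_closed: "M z \<in> S \<times> S" if "z \<in> S \<times> S" for z
    using that by (auto simp: M_def)
  have half_plus: "half_plus z = h (M z)" for z
    by (simp add: half_plus_def h_def M_def)
  have Mh: "M (h z) = h (M z)" if "z \<in> S \<times> S" for z
    using that by (auto simp: M_def h_def half_J half_add half_diff)
  have br_h: "complexify_br br (h z) w = h (complexify_br br z w)"
      "complexify_br br z (h w) = h (complexify_br br z w)" if "z \<in> S \<times> S" "w \<in> S \<times> S" for z w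
    using that by (auto simp: complexify_br_def h_def half_br half_br_right half_add half_diff)
  have h_closed: "h z \<in> S \<times> S" if "z \<in> S \<times> S" for z
    using that by (auto simp: h_def)
  interpret M: lie_ring_endo "S \<times> S" "complexify_br br" M
    by (intro lie_ring_endo.intro complexify_lie_ring lie_ring_endo_axioms.intro)
      (auto simp: M_def N_simps)
  have "contraction (complexify_br br) half_plus z w = h (contraction (complexify_br br) M z w)"
    using assms unfolding contraction_def half_plus by (simp add: br_h M_closed)
      (simp add: h_def half_add half_diff)
  then have "half_plus (contraction (complexify_br br) half_plus z w) =
      h (h (M (contraction (complexify_br br) M z w)))"
    using assms by (simp add: half_plus Mh)
  moreover have "complexify_br br (half_plus z) (half_plus w) = h (h (complexify_br br (M z) (M w)))"
    using assms by (simp add: half_plus br_h M_closed h_closed)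
  moreover have "complexify_br br (M z) (M w) = M (contraction (complexify_br br) M z w)"
    using assms by (auto simp: complexify_br_def M_def contraction_def br_simps N_simps J_torsion J_square)
  ultimately show ?thesis
    by simp
qed

lemmas half_plus_jacobi = lie_ring_endo.contraction_jacobi[OF half_plus_endo half_plus_torsion_free]

end

section \<open>Charts and tangent vectors\<close>

locale smooth_manifold =
  fixes A :: "('m::topological_space, 'n::finite) chart set"
  assumes atlas: "smooth_atlas A"
begin

abbreviation T where "T \<equiv> tangent_bundle A"

abbreviation \<Gamma> where "\<Gamma> \<equiv> sections A T"

lemma chart_cover: obtains c where "c \<in> charts_at A p"
  using atlas unfolding smooth_atlas_def charts_at_def by blast

lemma charts_at_iff: "c \<in> charts_at A p \<longleftrightarrow> c \<in> A \<and> p \<in> fst c"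
  by (simp add: charts_at_def)

lemma chart_open: "c \<in> A \<Longrightarrow> open (fst c)"
  using atlas unfolding smooth_atlas_def by blast

lemma chart_homeomorphism: "c \<in> A \<Longrightarrow> homeomorphism (fst c) (snd c ` fst c) (snd c) (chart_inv c)"
  using atlas unfolding smooth_atlas_def by blast

lemma chart_inv_chart [simp]: "c \<in> A \<Longrightarrow> p \<in> fst c \<Longrightarrow> chart_inv c (snd c p) = p"
  using chart_homeomorphism homeomorphism_apply1 by blast

lemma transition_chart: "c \<in> A \<Longrightarrow> p \<in> fst c \<Longrightarrow> transition c d (snd c p) = snd d p"
  by (simp add: transition_def)

lemma smooth_on_transition: "c \<in> A \<Longrightarrow> d \<in> A \<Longrightarrow> smooth_on (snd c ` (fst c \<inter> fst d)) (transition c d)"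
  using atlas unfolding smooth_atlas_def by blast

lemma open_chart_image:
  assumes "c \<in> A" "open W"
  shows "open (snd c ` (fst c \<inter> W))"
proof -
  have "openin (top_of_set (snd c ` fst c)) (snd c ` (fst c \<inter> W))"
    by (rule homeomorphism_imp_open_map[OF chart_homeomorphism[OF assms(1)]])
      (simp add: assms(2) openin_open_Int)
  moreover have "open (snd c ` fst c)"
    using assms(1) atlas unfolding smooth_atlas_def by blast
  ultimately show ?thesis
    using openin_open_eq by blast
qed

lemma open_chart_image': "c \<in> A \<Longrightarrow> open (snd c ` fst c)"
  using open_chart_image[of c UNIV] by simp

lemma mfd_smooth_onD:
  "mfd_smooth_on A W f \<Longrightarrow> c \<in> A \<Longrightarrow> W \<subseteq> fst c \<Longrightarrow> smooth_on (snd c ` W) (f \<circ> chart_inv c)"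
  unfolding mfd_smooth_on_def by (metis inf.absorb2)

text \<open>One chart containing \<open>W\<close> suffices: the expression in any other chart is
  this one composed with a smooth transition map.\<close>

lemma mfd_smooth_on_chartI:
  assumes c: "c \<in> A" "open W" "W \<subseteq> fst c" and f: "smooth_on (snd c ` W) (f \<circ> chart_inv c)"
  shows "mfd_smooth_on A W f"
  unfolding mfd_smooth_on_def
proof
  fix d assume d: "d \<in> A"
  have open_d: "open (snd d ` (fst d \<inter> W))"
    using d c by (intro open_chart_image)
  have "transition d c ` (snd d ` (fst d \<inter> W)) \<subseteq> snd c ` W"
    using d by (auto simp: transition_chart)
  moreover have "smooth_on (snd d ` (fst d \<inter> W)) (transition d c)"
    using c d by (intro smooth_on_subset[OF smooth_on_transition]) auto
  ultimately have "smooth_on (snd d ` (fst d \<inter> W)) (\<lambda>x. (f \<circ> chart_inv c) (transition d c x))"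
    by (rule smooth_on_compose[OF open_d _ _ f])
  then show "smooth_on (snd d ` (fst d \<inter> W)) (f \<circ> chart_inv d)"
  proof (rule smooth_on_cong[OF open_d, rotated])
    fix x assume "x \<in> snd d ` (fst d \<inter> W)"
    then obtain p where "x = snd d p" "p \<in> fst d" "p \<in> fst c"
      using c(3) by blast
    then show "(f \<circ> chart_inv c) (transition d c x) = (f \<circ> chart_inv d) x"
      using c d by (simp add: transition_chart)
  qed
qed

lemma mfd_smooth_on_cong:
  assumes "open W" "mfd_smooth_on A W f" "\<And>p. p \<in> W \<Longrightarrow> f p = g p"
  shows "mfd_smooth_on A W g"
  unfolding mfd_smooth_on_def
proof
  fix c assume c: "c \<in> A"
  then have "smooth_on (snd c ` (fst c \<inter> W)) (f \<circ> chart_inv c)"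
    using assms(2) by (simp add: mfd_smooth_on_def)
  then show "smooth_on (snd c ` (fst c \<inter> W)) (g \<circ> chart_inv c)"
    by (rule smooth_on_cong[OF open_chart_image[OF c assms(1)], rotated]) (use assms c in auto)
qed

lemma mfd_smooth_on_subset: "mfd_smooth_on A W f \<Longrightarrow> V \<subseteq> W \<Longrightarrow> mfd_smooth_on A V f"
  unfolding mfd_smooth_on_def by (blast intro: smooth_on_subset)

lemma mfd_smooth_on_const: "mfd_smooth_on A W (\<lambda>p. a)"
  by (simp add: mfd_smooth_on_def comp_def smooth_on_const)

lemma mfd_smooth_on_bounded_linear:
  "open W \<Longrightarrow> bounded_linear h \<Longrightarrow> mfd_smooth_on A W f \<Longrightarrow> mfd_smooth_on A W (\<lambda>p. h (f p))"
  unfolding mfd_smooth_on_def comp_def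
  using smooth_on_bounded_linear open_chart_image by blast

lemma mfd_smooth_on_add:
  "open W \<Longrightarrow> mfd_smooth_on A W f \<Longrightarrow> mfd_smooth_on A W g \<Longrightarrow> mfd_smooth_on A W (\<lambda>p. f p + g p)"
  unfolding mfd_smooth_on_def comp_def
  using smooth_on_add open_chart_image by blast

lemma mfd_smooth_on_diff:
  "open W \<Longrightarrow> mfd_smooth_on A W f \<Longrightarrow> mfd_smooth_on A W g \<Longrightarrow> mfd_smooth_on A W (\<lambda>p. f p - g p)"
  unfolding mfd_smooth_on_def comp_def
  using smooth_on_diff open_chart_image by blast

lemma mfd_smooth_on_scaleR:
  "open W \<Longrightarrow> mfd_smooth_on A W f \<Longrightarrow> mfd_smooth_on A W g \<Longrightarrow> mfd_smooth_on A W (\<lambda>p. f p *\<^sub>R g p)"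
  unfolding mfd_smooth_on_def comp_def
  using smooth_on_scaleR open_chart_image by blast

lemma mfd_smooth_on_sum:
  "open W \<Longrightarrow> (\<And>i. i \<in> I \<Longrightarrow> mfd_smooth_on A W (f i)) \<Longrightarrow> mfd_smooth_on A W (\<lambda>p. \<Sum>i\<in>I. f i p)"
  unfolding mfd_smooth_on_def comp_def
  by (auto intro!: smooth_on_sum open_chart_image)

section \<open>Tangent vectors and their coordinates\<close>

definition Dtrans :: "('m, 'n) chart \<Rightarrow> ('m, 'n) chart \<Rightarrow> 'm \<Rightarrow> real^'n \<Rightarrow> real^'n" where
  "Dtrans c d p = frechet_derivative (transition c d) (at (snd c p))"

lemma linear_Dtrans: "c \<in> charts_at A p \<Longrightarrow> d \<in> charts_at A p \<Longrightarrow> linear (Dtrans c d p)"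
  unfolding Dtrans_def charts_at_iff
  by (intro smooth_on_linear_derivative[OF smooth_on_transition]) auto

lemma Dtrans_self: "c \<in> charts_at A p \<Longrightarrow> Dtrans c c p v = v"
  unfolding Dtrans_def charts_at_iff
  by (subst frechet_derivative_cong_open[OF open_chart_image', of c _ _ "\<lambda>x. x"])
    (auto simp: transition_chart)

text \<open>The cocycle rule: transition maps compose on the image of the triple overlap, an open
  neighbourhood of the point, and the chain rule does the rest.\<close>

lemma Dtrans_Dtrans:
  assumes "c \<in> charts_at A p" "d \<in> charts_at A p" "e \<in> charts_at A p"
  shows "Dtrans d e p (Dtrans c d p v) = Dtrans c e p v"
proof -
  let ?S = "snd c ` (fst c \<inter> (fst d \<inter> fst e))"
  have S: "open ?S" "snd c p \<in> ?S"
    using assms by (auto intro!: open_chart_image simp: charts_at_iff chart_open)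
  have "frechet_derivative (\<lambda>x. transition d e (transition c d x)) (at (snd c p)) v
      = frechet_derivative (transition c e) (at (snd c p)) v"
    by (subst frechet_derivative_cong_open[OF S, where g = "transition c e"])
      (use assms in \<open>auto simp: transition_chart charts_at_iff\<close>)
  moreover have "frechet_derivative (\<lambda>x. transition d e (transition c d x)) (at (snd c p)) v
      = frechet_derivative (transition d e) (at (transition c d (snd c p)))
        (frechet_derivative (transition c d) (at (snd c p)) v)"
    using assms unfolding charts_at_iff
    by (intro frechet_derivative_chain[OF smooth_on_transition _ smooth_on_transition])
      (auto simp: transition_chart)
  ultimately show ?thesis
    using assms by (simp add: Dtrans_def transition_chart charts_at_iff)
qed

lemma T_simps [simp]:
  "proj T = fst"
  "vadd T (p, v) (p', v') = (p, v + v')"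
  "vzero T p = (p, 0)"
  "vscale T a (p, v) = (p, \<lambda>c. a *\<^sub>R v c)"
  "trivs T = (\<lambda>c. (fst c, \<lambda>e. snd e c)) ` A"
  by (auto simp: tangent_bundle_def plus_fun_def zero_fun_def scalar_mult_eq_scaleR)

lemma fibre_T_iff: "(q, v) \<in> fibre T p \<longleftrightarrow> q = p
    \<and> (\<forall>c\<in>charts_at A p. \<forall>d\<in>charts_at A p. Dtrans c d p (v c) = v d)
    \<and> (\<forall>c. c \<notin> charts_at A p \<longrightarrow> v c = 0)"
  by (simp add: fibre_def tangent_bundle_def Dtrans_def)
    (metis (no_types, lifting))

lemma fibre_T_fst: "e \<in> fibre T p \<Longrightarrow> fst e = p"
  by (simp add: fibre_def)

lemma fibre_T_zero: "(p, 0) \<in> fibre T p"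
  by (simp add: fibre_T_iff linear_0[OF linear_Dtrans])

lemma fibre_T_add: "(p, v) \<in> fibre T p \<Longrightarrow> (p, w) \<in> fibre T p \<Longrightarrow> (p, v + w) \<in> fibre T p"
  by (simp add: fibre_T_iff linear_add[OF linear_Dtrans])

lemma fibre_T_scale: "(p, v) \<in> fibre T p \<Longrightarrow> (p, \<lambda>c. a *\<^sub>R v c) \<in> fibre T p"
  by (simp add: fibre_T_iff linear_cmul[OF linear_Dtrans])

lemma fibre_T_comb:
  assumes "(p, v) \<in> fibre T p" "(p, w) \<in> fibre T p"
  shows "(p, \<lambda>c. r *\<^sub>R v c + s *\<^sub>R w c) \<in> fibre T p"
  using fibre_T_add[OF fibre_T_scale[OF assms(1), of r] fibre_T_scale[OF assms(2), of s]]
  by (simp add: plus_fun_def)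

text \<open>The inverse of the trivialization given by \<open>c\<close> on the fibre over
  \<open>p\<close>: coordinates in \<open>c\<close> are propagated to the other charts at
  \<open>p\<close>. The value 0 elsewhere is the normalization built into
  \<open>tangent_bundle\<close>.\<close>

definition tvec_of :: "('m, 'n) chart \<Rightarrow> 'm \<Rightarrow> real^'n \<Rightarrow> ('m, 'n) chart \<Rightarrow> real^'n" where
  "tvec_of c p w = (\<lambda>d. if d \<in> charts_at A p then Dtrans c d p w else 0)"

lemma tvec_of_fibre: "c \<in> charts_at A p \<Longrightarrow> (p, tvec_of c p w) \<in> fibre T p"
  by (auto simp: fibre_T_iff tvec_of_def Dtrans_Dtrans)

lemma tvec_of_chart: "c \<in> charts_at A p \<Longrightarrow> tvec_of c p w c = w"
  by (simp add: tvec_of_def Dtrans_self)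

lemma tvec_of_eq: "(p, v) \<in> fibre T p \<Longrightarrow> c \<in> charts_at A p \<Longrightarrow> tvec_of c p (v c) = v"
  by (rule ext) (simp add: fibre_T_iff tvec_of_def split_paired_all)

lemma fibre_T_eqI:
  "(p, v) \<in> fibre T p \<Longrightarrow> (p, w) \<in> fibre T p \<Longrightarrow> c \<in> charts_at A p \<Longrightarrow> v c = w c \<Longrightarrow> v = w"
  by (metis tvec_of_eq)

lemma tvec_of_snd: "e \<in> fibre T p \<Longrightarrow> c \<in> charts_at A p \<Longrightarrow> (p, tvec_of c p (snd e c)) = e"
  by (metis fibre_T_fst prod.collapse tvec_of_eq)

lemma bij_betw_triv_T: "c \<in> charts_at A p \<Longrightarrow> bij_betw (\<lambda>e. snd e c) (fibre T p) UNIV"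
  by (rule bij_betw_byWitness[where f' = "\<lambda>w. (p, tvec_of c p w)"])
    (simp_all add: tvec_of_chart tvec_of_snd image_subset_iff tvec_of_fibre)

lemma inv_triv_T: "c \<in> charts_at A p \<Longrightarrow> inv_into (fibre T p) (\<lambda>e. snd e c) w = (p, tvec_of c p w)"
  by (rule inv_into_f_eq) (auto simp: bij_betw_imp_inj_on[OF bij_betw_triv_T] tvec_of_fibre tvec_of_chart)

lemma mfd_smooth_on_tvec_of:
  assumes "c \<in> A" "d \<in> A"
  shows "mfd_smooth_on A (fst c \<inter> fst d) (\<lambda>p. tvec_of c p w d)"
proof (rule mfd_smooth_on_chartI[OF assms(1)])
  have S: "open (snd c ` (fst c \<inter> fst d))"
    using assms by (intro open_chart_image chart_open)
  have "frechet_derivative (transition c d) (at x) w = ((\<lambda>p. tvec_of c p w d) \<circ> chart_inv c) x"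
    if x: "x \<in> snd c ` (fst c \<inter> fst d)" for x
  proof -
    obtain p where "x = snd c p" "p \<in> fst c" "p \<in> fst d"
      using x by blast
    then show ?thesis
      using assms by (simp add: tvec_of_def Dtrans_def charts_at_iff)
  qed
  then show "smooth_on (snd c ` (fst c \<inter> fst d)) ((\<lambda>p. tvec_of c p w d) \<circ> chart_inv c)"
    by (rule smooth_on_cong[OF S _ smooth_on_derivative_const[OF smooth_on_transition[OF assms]]])
qed (use assms chart_open in blast)+

subsection \<open>Vector fields\<close>

lemma sections_T_iff:
  "X \<in> \<Gamma> \<longleftrightarrow> (\<forall>p. X p \<in> fibre T p) \<and> (\<forall>c\<in>A. mfd_smooth_on A (fst c) (\<lambda>p. snd (X p) c))"
  by (auto simp: sections_def comp_def)

text \<open>The component of a field in chart \<open>c\<close> can be tested in \<open>c\<close>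
  itself, which reduces smoothness of fields to Euclidean calculus.\<close>

lemma sections_T_coord_iff:
  "X \<in> \<Gamma> \<longleftrightarrow> (\<forall>p. X p \<in> fibre T p) \<and> (\<forall>c\<in>A. smooth_on (snd c ` fst c) (coord_field c X))"
proof -
  have "mfd_smooth_on A (fst c) (\<lambda>p. snd (X p) c) \<longleftrightarrow> smooth_on (snd c ` fst c) (coord_field c X)"
    if "c \<in> A" for c
    using mfd_smooth_onD[of "fst c" "\<lambda>p. snd (X p) c" c]
      mfd_smooth_on_chartI[OF that, of "fst c" "\<lambda>p. snd (X p) c"] that chart_open
    by (auto simp: coord_field_def comp_def)
  then show ?thesis
    by (auto simp: sections_T_iff)
qed

lemma coord_field_transition:
  assumes "X \<in> \<Gamma>" "c \<in> A" "d \<in> A" "x \<in> snd c ` (fst c \<inter> fst d)"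
  shows "coord_field d X (transition c d x) = frechet_derivative (transition c d) (at x) (coord_field c X x)"
proof -
  obtain p where p: "p \<in> fst c" "p \<in> fst d" "x = snd c p"
    using assms by auto
  have "(p, snd (X p)) \<in> fibre T p"
    using assms(1) fibre_T_fst[of "X p" p] by (metis prod.collapse sections_T_iff)
  then show ?thesis
    using p assms by (simp add: coord_field_def transition_chart fibre_T_iff Dtrans_def charts_at_iff)
qed

lemma coord_field_lie_bracket:
  assumes "c \<in> A" "p \<in> fst c"
  shows "coord_field c (lie_bracket A X Y) (snd c p) = coord_bracket (coord_field c X) (coord_field c Y) (snd c p)"
  using assms by (simp add: coord_field_def lie_bracket_def coord_bracket_def charts_at_iff)

lemma lie_bracket_apply:
  "c \<in> charts_at A p \<Longrightarrow>
    snd (lie_bracket A X Y p) c = coord_bracket (coord_field c X) (coord_field c Y) (snd c p)"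
  by (simp add: coord_field_def lie_bracket_def coord_bracket_def charts_at_iff)

text \<open>\<open>lie_bracket\<close> is computed in each chart separately, so the results must be
  shown to fit together. The coordinate expressions of a field in two charts are related by the
  transition map, and \<open>coord_bracket_related\<close> passes this on to the brackets.\<close>

lemma lie_bracket_sections:
  assumes X: "X \<in> \<Gamma>" and Y: "Y \<in> \<Gamma>"
  shows "lie_bracket A X Y \<in> \<Gamma>"
  unfolding sections_T_coord_iff
proof (intro conjI allI ballI)
  fix p
  have "Dtrans c d p (snd (lie_bracket A X Y p) c) = snd (lie_bracket A X Y p) d"
    if cd: "c \<in> charts_at A p" "d \<in> charts_at A p" for c d
  proof -
    have A: "c \<in> A" "d \<in> A" "p \<in> fst c" "p \<in> fst d"
      using cd by (auto simp: charts_at_iff)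
    have "coord_bracket (coord_field d X) (coord_field d Y) (transition c d (snd c p)) =
      frechet_derivative (transition c d) (at (snd c p)) (coord_bracket (coord_field c X) (coord_field c Y) (snd c p))"
    proof (rule coord_bracket_related[where S = "snd c ` (fst c \<inter> fst d)" and S' = "snd d ` fst d"])
      show "smooth_on (snd c ` (fst c \<inter> fst d)) (coord_field c X)"
          "smooth_on (snd c ` (fst c \<inter> fst d)) (coord_field c Y)"
        using X Y A by (auto simp: sections_T_coord_iff intro: smooth_on_subset)
      show "smooth_on (snd d ` fst d) (coord_field d X)" "smooth_on (snd d ` fst d) (coord_field d Y)"
        using X Y A by (auto simp: sections_T_coord_iff)
    qed (use A X Y in \<open>auto intro!: open_chart_image chart_open smooth_on_transition coord_field_transition
        simp: transition_chart\<close>)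
    then show ?thesis
      using A cd by (simp add: lie_bracket_apply Dtrans_def transition_chart)
  qed
  moreover have "lie_bracket A X Y p = (p, snd (lie_bracket A X Y p))"
    by (simp add: lie_bracket_def)
  moreover have "snd (lie_bracket A X Y p) c = 0" if "c \<notin> charts_at A p" for c
    using that by (simp add: lie_bracket_def)
  ultimately show "lie_bracket A X Y p \<in> fibre T p"
    by (metis fibre_T_iff)
next
  fix c assume c: "c \<in> A"
  have "smooth_on (snd c ` fst c) (coord_bracket (coord_field c X) (coord_field c Y))"
    using X Y c by (intro smooth_on_coord_bracket open_chart_image') (auto simp: sections_T_coord_iff)
  then show "smooth_on (snd c ` fst c) (coord_field c (lie_bracket A X Y))"
    by (rule smooth_on_cong[OF open_chart_image'[OF c], rotated]) (auto simp: coord_field_lie_bracket c)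
qed

text \<open>\<open>tangent_act\<close> differentiates in a chart picked by \<open>SOME\<close>. The
  chain rule along the transition map moves both the function and the vector to
  \<open>d\<close>.\<close>

lemma tangent_act_chart:
  assumes f: "mfd_smooth_on A UNIV f" and e: "e \<in> fibre T p" and d: "d \<in> charts_at A p"
  shows "tangent_act A e f = frechet_derivative (f \<circ> chart_inv d) (at (snd d p)) (snd e d)"
proof -
  define c where "c = (SOME c. c \<in> charts_at A p)"
  have c: "c \<in> charts_at A p"
    unfolding c_def using chart_cover[of p] by (metis someI)
  have smooth: "smooth_on (snd c ` fst c) (f \<circ> chart_inv c)" if "c \<in> A" for c
    using f that by (auto simp: mfd_smooth_on_def)
  let ?S = "snd c ` (fst c \<inter> fst d)"
  have A: "c \<in> A" "d \<in> A" "p \<in> fst c" "p \<in> fst d"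
    using c d by (auto simp: charts_at_iff)
  have S: "open ?S" "snd c p \<in> ?S"
    using A by (auto intro!: open_chart_image chart_open)
  have "frechet_derivative (f \<circ> chart_inv c) (at (snd c p)) (snd e c) =
      frechet_derivative (\<lambda>x. (f \<circ> chart_inv d) (transition c d x)) (at (snd c p)) (snd e c)"
    by (subst frechet_derivative_cong_open[OF S, where g = "\<lambda>x. (f \<circ> chart_inv d) (transition c d x)"])
      (use A in \<open>auto simp: transition_chart\<close>)
  also have "\<dots> = frechet_derivative (f \<circ> chart_inv d) (at (transition c d (snd c p))) (Dtrans c d p (snd e c))"
    unfolding Dtrans_def using A
    by (intro frechet_derivative_chain[OF smooth_on_transition _ smooth]) (auto simp: transition_chart)
  also have "Dtrans c d p (snd e c) = snd e d"
    using e c d by (cases e) (auto simp: fibre_T_iff)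
  finally show ?thesis
    using A fibre_T_fst[OF e] by (simp add: tangent_act_def Let_def c_def transition_chart comp_def)
qed

lemma tangent_act_const: "tangent_act A e (\<lambda>p. a) = 0"
  by (simp add: tangent_act_def Let_def comp_def)

text \<open>Dropping the base points turns the vector fields into an additive subgroup \<open>fields\<close> of a type in
  class \<open>ab_group_add\<close>.\<close>

definition vf :: "('m \<Rightarrow> ('m, 'n) chart \<Rightarrow> real^'n) \<Rightarrow> 'm \<Rightarrow> ('m, 'n) tvec" where
  "vf V = (\<lambda>p. (p, V p))"

definition fields :: "('m \<Rightarrow> ('m, 'n) chart \<Rightarrow> real^'n) set" where
  "fields = {V. vf V \<in> \<Gamma>}"

definition fields_br ::
    "('m \<Rightarrow> ('m, 'n) chart \<Rightarrow> real^'n) \<Rightarrow> ('m \<Rightarrow> ('m, 'n) chart \<Rightarrow> real^'n) \<Rightarrow>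
      'm \<Rightarrow> ('m, 'n) chart \<Rightarrow> real^'n" where
  "fields_br V W = (\<lambda>p. snd (lie_bracket A (vf V) (vf W) p))"

definition fscale ::
    "('m \<Rightarrow> real) \<Rightarrow> ('m \<Rightarrow> ('m, 'n) chart \<Rightarrow> real^'n) \<Rightarrow> 'm \<Rightarrow> ('m, 'n) chart \<Rightarrow> real^'n" where
  "fscale g V = (\<lambda>p c. g p *\<^sub>R V p c)"

lemma fscale_apply: "fscale g V p c = g p *\<^sub>R V p c"
  by (simp add: fscale_def)

lemma fscale_const [simp]: "fscale (\<lambda>_. 0) V = 0" "fscale (\<lambda>_. 1) V = V" "fscale (\<lambda>_. - 1) V = - V"
  by (simp_all add: fscale_def fun_eq_iff)

lemma vf_fields_br: "vf (fields_br V W) = lie_bracket A (vf V) (vf W)"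
  by (simp add: vf_def fields_br_def lie_bracket_def)

lemma fields_iff:
  "V \<in> fields \<longleftrightarrow> (\<forall>p. (p, V p) \<in> fibre T p) \<and> (\<forall>c\<in>A. mfd_smooth_on A (fst c) (\<lambda>p. V p c))"
  by (simp add: fields_def sections_T_iff vf_def)

lemma fields_fibre: "V \<in> fields \<Longrightarrow> (p, V p) \<in> fibre T p"
  by (simp add: fields_iff)

lemma fields_outside: "V \<in> fields \<Longrightarrow> c \<notin> charts_at A p \<Longrightarrow> V p c = 0"
  using fields_fibre[of V p] unfolding fibre_T_iff by blast

lemma smooth_on_coord_field: "V \<in> fields \<Longrightarrow> c \<in> A \<Longrightarrow> smooth_on (snd c ` fst c) (coord_field c (vf V))"
  unfolding fields_def sections_T_coord_iff by blast

lemma coord_field_vf: "c \<in> charts_at A p \<Longrightarrow> coord_field c (vf V) (snd c p) = V p c"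
  by (simp add: coord_field_def vf_def charts_at_iff)

lemma fields_br_apply:
  "c \<in> charts_at A p \<Longrightarrow>
    fields_br V W p c = coord_bracket (coord_field c (vf V)) (coord_field c (vf W)) (snd c p)"
  by (simp add: fields_br_def lie_bracket_apply)

lemma fields_br_outside: "c \<notin> charts_at A p \<Longrightarrow> fields_br V W p c = 0"
  by (simp add: fields_br_def lie_bracket_def)

lemma coord_field_fields_br:
  "c \<in> A \<Longrightarrow> x \<in> snd c ` fst c \<Longrightarrow>
    coord_field c (vf (fields_br V W)) x = coord_bracket (coord_field c (vf V)) (coord_field c (vf W)) x"
  unfolding vf_fields_br by (elim imageE) (simp only: coord_field_lie_bracket)

text \<open>Tangent vectors vanish at all charts not around their base point, so equality has to be
  checked only where coordinate formulas are valid.\<close>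

lemma fields_eqI:
  assumes "V \<in> fields" "W \<in> fields" "\<And>p c. c \<in> charts_at A p \<Longrightarrow> V p c = W p c"
  shows "V = W"
proof (intro ext)
  fix p c
  show "V p c = W p c"
    using assms(3) fields_outside[OF assms(1)] fields_outside[OF assms(2)]
    by (cases "c \<in> charts_at A p") simp_all
qed

lemma fields_zero: "0 \<in> fields"
  by (simp add: fields_iff fibre_T_zero mfd_smooth_on_const)

lemma fields_add: "V \<in> fields \<Longrightarrow> W \<in> fields \<Longrightarrow> V + W \<in> fields"
  by (simp add: fields_iff fibre_T_add mfd_smooth_on_add chart_open)

lemma fields_scale:
  assumes "V \<in> fields" "mfd_smooth_on A UNIV g"
  shows "fscale g V \<in> fields"
  unfolding fields_iff fscale_def
proof (intro conjI allI ballI)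
  fix c assume "c \<in> A"
  then show "mfd_smooth_on A (fst c) (\<lambda>p. g p *\<^sub>R V p c)"
    using assms by (intro mfd_smooth_on_scaleR chart_open mfd_smooth_on_subset[OF assms(2)]) (auto simp: fields_iff)
qed (rule fibre_T_scale[OF fields_fibre[OF assms(1)]])

lemma fields_br_closed: "V \<in> fields \<Longrightarrow> W \<in> fields \<Longrightarrow> fields_br V W \<in> fields"
  unfolding fields_def by (simp add: vf_fields_br lie_bracket_sections)

lemma charts_at_image: "c \<in> charts_at A p \<Longrightarrow> snd c p \<in> snd c ` fst c"
  by (simp add: charts_at_iff)

sublocale F: lie_ring_on fields fields_br
proof
  fix V W assume VW: "V \<in> fields" "W \<in> fields"
  show "fields_br V V = 0"
  proof (intro ext)
    show "fields_br V V p c = 0 p c" for p c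
      by (cases "c \<in> charts_at A p") (simp_all add: fields_br_apply fields_br_outside coord_bracket_def)
  qed
  show "fields_br V W = - fields_br W V"
  proof (intro ext)
    show "fields_br V W p c = (- fields_br W V) p c" for p c
      by (cases "c \<in> charts_at A p") (simp_all add: fields_br_apply fields_br_outside coord_bracket_def)
  qed
  show "V + W \<in> fields" "fields_br V W \<in> fields"
    using VW by (simp_all add: fields_add fields_br_closed)
  show "- V \<in> fields"
    using fields_scale[OF VW(1) mfd_smooth_on_const, of "- 1"] by simp
  fix U assume U: "U \<in> fields"
  show "fields_br (V + W) U = fields_br V U + fields_br W U"
  proof (rule fields_eqI)
    fix p c assume c: "c \<in> charts_at A p"
    have "coord_field c (vf (V + W)) = (\<lambda>x. coord_field c (vf V) x + coord_field c (vf W) x)"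
      by (simp add: coord_field_def vf_def)
    then show "fields_br (V + W) U p c = (fields_br V U + fields_br W U) p c"
      using c coord_bracket_add_left[OF smooth_on_coord_field[OF VW(1)] smooth_on_coord_field[OF VW(2)]
          smooth_on_coord_field[OF U] charts_at_image[OF c]]
      by (simp add: fields_br_apply charts_at_iff)
  qed (use VW U in \<open>simp_all add: fields_br_closed fields_add\<close>)
  show "fields_br V (fields_br W U) + fields_br W (fields_br U V) + fields_br U (fields_br V W) = 0"
  proof (rule fields_eqI)
    fix p c assume c: "c \<in> charts_at A p"
    then have A: "c \<in> A"
      by (simp add: charts_at_iff)
    \<comment> \<open>The inner bracket agrees with its coordinate formula on the chart image only;
      since that image is open, it may still be replaced under the outer derivative.\<close>
    have *: "fields_br V (fields_br W U) p c = coord_bracket (coord_field c (vf V))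
        (coord_bracket (coord_field c (vf W)) (coord_field c (vf U))) (snd c p)" for V W U
      unfolding fields_br_apply[OF c]
      by (rule coord_bracket_cong[OF open_chart_image'[OF A] charts_at_image[OF c]])
        (simp_all add: coord_field_fields_br A)
    show "(fields_br V (fields_br W U) + fields_br W (fields_br U V) + fields_br U (fields_br V W)) p c = 0 p c"
      using coord_bracket_jacobi[OF open_chart_image'[OF A] charts_at_image[OF c] smooth_on_coord_field[OF VW(1) A]
          smooth_on_coord_field[OF VW(2) A] smooth_on_coord_field[OF U A]]
      by (simp add: *)
  qed (use VW U in \<open>simp_all add: fields_br_closed fields_add fields_zero\<close>)
qed (rule fields_zero)

lemma fields_br_scale_right:
  assumes V: "V \<in> fields" and W: "W \<in> fields" and g: "mfd_smooth_on A UNIV g"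
  shows "fields_br V (fscale g W) = fscale g (fields_br V W) + fscale (\<lambda>p. tangent_act A (vf V p) g) W"
proof (intro ext)
  fix p c
  show "fields_br V (fscale g W) p c
      = (fscale g (fields_br V W) + fscale (\<lambda>p. tangent_act A (vf V p) g) W) p c"
  proof (cases "c \<in> charts_at A p")
    case True
    then have A: "c \<in> A" "p \<in> fst c"
      by (simp_all add: charts_at_iff)
    have g': "smooth_on (snd c ` fst c) (g \<circ> chart_inv c)"
      using mfd_smooth_onD[OF mfd_smooth_on_subset[OF g], of "fst c" c] A by simp
    have "coord_field c (vf (fscale g W)) = (\<lambda>x. (g \<circ> chart_inv c) x *\<^sub>R coord_field c (vf W) x)"
      by (simp add: coord_field_def vf_def fscale_def)
    moreover have "tangent_act A (vf V p) g = frechet_derivative (g \<circ> chart_inv c) (at (snd c p)) (V p c)"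
      using tangent_act_chart[OF g fields_fibre[OF V] True] by (simp add: vf_def)
    ultimately show ?thesis
      using coord_bracket_scaleR_right[OF smooth_on_coord_field[OF V A(1)] smooth_on_coord_field[OF W A(1)] g'
          charts_at_image[OF True]] True A
      by (simp add: fields_br_apply fscale_apply coord_field_vf)
  next
    case False
    then show ?thesis
      using fields_outside[OF W] by (simp add: fields_br_outside fscale_apply)
  qed
qed

lemma mfd_smooth_on_tangent_act:
  fixes g :: "'m \<Rightarrow> 'b::real_normed_vector"
  assumes V: "V \<in> fields" and g: "mfd_smooth_on A UNIV g"
  shows "mfd_smooth_on A UNIV (\<lambda>p. tangent_act A (vf V p) g)"
  unfolding mfd_smooth_on_def
proof
  fix c assume c: "c \<in> A"
  have "smooth_on (snd c ` fst c) (\<lambda>x. frechet_derivative (g \<circ> chart_inv c) (at x) (coord_field c (vf V) x))"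
    using g c by (intro smooth_on_derivative open_chart_image' smooth_on_coord_field V)
      (auto simp: mfd_smooth_on_def)
  then have "smooth_on (snd c ` fst c) ((\<lambda>p. tangent_act A (vf V p) g) \<circ> chart_inv c)"
  proof (rule smooth_on_cong[OF open_chart_image'[OF c], rotated])
    fix x assume "x \<in> snd c ` fst c"
    then obtain p where p: "x = snd c p" "p \<in> fst c"
      by blast
    then have "c \<in> charts_at A p"
      using c by (simp add: charts_at_iff)
    from tangent_act_chart[OF g fields_fibre[OF V] this]
    show "frechet_derivative (g \<circ> chart_inv c) (at x) (coord_field c (vf V) x) =
        ((\<lambda>p. tangent_act A (vf V p) g) \<circ> chart_inv c) x"
      using p c by (simp add: coord_field_def vf_def)
  qed
  then show "smooth_on (snd c ` (fst c \<inter> UNIV)) ((\<lambda>p. tangent_act A (vf V p) g) \<circ> chart_inv c)"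
    by simp
qed

text \<open>Constants have derivative 0, so the Leibniz rule gives homogeneity on the right;
  antisymmetry moves it to the left.\<close>

lemma fields_br_scale_const:
  assumes "V \<in> fields" "W \<in> fields"
  shows "fields_br (fscale (\<lambda>_. a) V) W = fscale (\<lambda>_. a) (fields_br V W)"
proof -
  have "fields_br W (fscale (\<lambda>_. a) V) = fscale (\<lambda>_. a) (fields_br W V)"
    using fields_br_scale_right[OF assms(2,1) mfd_smooth_on_const, of a]
    by (simp add: tangent_act_const)
  then show ?thesis
    using assms F.br_antisym[of V W] F.br_antisym[of "fscale (\<lambda>_. a) V" W]
      fields_scale[OF assms(1) mfd_smooth_on_const]
    by (simp add: fscale_def fun_eq_iff)
qed

end

section \<open>The complex structure as an operator on real vector fields\<close>

locale complex_manifold = smooth_manifold A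
  for A :: "('m::topological_space, 'n::finite) chart set" +
  fixes J :: "('m, 'n) tvec \<Rightarrow> ('m, 'n) tvec"
  assumes J: "complex_structure A J"
begin

lemma J_bundle_map: "bundle_map A T T J"
  using J by (simp add: complex_structure_def almost_complex_structure_def)

lemma J_fibre: "e \<in> fibre T p \<Longrightarrow> J e \<in> fibre T p"
  using J_bundle_map by (simp add: bundle_map_def)

definition Jv :: "'m \<Rightarrow> (('m, 'n) chart \<Rightarrow> real^'n) \<Rightarrow> ('m, 'n) chart \<Rightarrow> real^'n" where
  "Jv p v = snd (J (p, v))"

lemma J_eq: "(p, v) \<in> fibre T p \<Longrightarrow> J (p, v) = (p, Jv p v)"
  unfolding Jv_def by (metis J_fibre fibre_T_fst prod.collapse)

lemma Jv_fibre: "(p, v) \<in> fibre T p \<Longrightarrow> (p, Jv p v) \<in> fibre T p"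
  using J_fibre J_eq by metis

lemma Jv_add: "(p, v) \<in> fibre T p \<Longrightarrow> (p, w) \<in> fibre T p \<Longrightarrow> Jv p (v + w) = Jv p v + Jv p w"
proof -
  assume *: "(p, v) \<in> fibre T p" "(p, w) \<in> fibre T p"
  then have "J (vadd T (p, v) (p, w)) = vadd T (J (p, v)) (J (p, w))"
    using J_bundle_map unfolding bundle_map_def by blast
  then show ?thesis
    using * by (simp add: J_eq fibre_T_add)
qed

lemma Jv_scale: "(p, v) \<in> fibre T p \<Longrightarrow> Jv p (\<lambda>c. a *\<^sub>R v c) = (\<lambda>c. a *\<^sub>R Jv p v c)"
proof -
  assume *: "(p, v) \<in> fibre T p"
  then have "J (vscale T a (p, v)) = vscale T a (J (p, v))"
    using J_bundle_map unfolding bundle_map_def by blast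
  then show ?thesis
    using * by (simp add: J_eq fibre_T_scale)
qed

lemma Jv_Jv: "(p, v) \<in> fibre T p \<Longrightarrow> Jv p (Jv p v) = - v"
proof -
  assume *: "(p, v) \<in> fibre T p"
  then have "J (J (p, v)) = vscale T (- 1) (p, v)"
    using J unfolding complex_structure_def almost_complex_structure_def by (simp add: fibre_def)
  then show ?thesis
    using * by (simp add: J_eq Jv_fibre fun_Compl_def)
qed

lemma linear_Jv_tvec_of: "c \<in> charts_at A p \<Longrightarrow> linear (\<lambda>w. Jv p (tvec_of c p w) d)"
proof (rule linearI)
  assume c: "c \<in> charts_at A p"
  have "tvec_of c p (v + w) = tvec_of c p v + tvec_of c p w" for v w
    by (rule fibre_T_eqI[OF _ _ c]) (simp_all add: c tvec_of_fibre fibre_T_add tvec_of_chart)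
  then show "Jv p (tvec_of c p (v + w)) d = Jv p (tvec_of c p v) d + Jv p (tvec_of c p w) d" for v w
    by (simp add: Jv_add tvec_of_fibre c)
  have "tvec_of c p (a *\<^sub>R v) = (\<lambda>d. a *\<^sub>R tvec_of c p v d)" for a v
    by (rule fibre_T_eqI[OF _ _ c]) (simp_all add: c tvec_of_fibre fibre_T_scale tvec_of_chart)
  then show "Jv p (tvec_of c p (a *\<^sub>R v)) d = a *\<^sub>R Jv p (tvec_of c p v) d" for a v
    by (simp add: Jv_scale tvec_of_fibre c)
qed

lemma mfd_smooth_on_Jv_tvec_of:
  assumes "c \<in> A" "d \<in> A"
  shows "mfd_smooth_on A (fst c \<inter> fst d) (\<lambda>p. Jv p (tvec_of c p w) d)"
proof -
  have "mfd_smooth_on A (fst c \<inter> fst d) (\<lambda>p. snd (J (inv_into (fibre T p) (\<lambda>e. snd e c) w)) d)"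
    using J_bundle_map assms unfolding bundle_map_def by (fastforce simp: case_prod_beta)
  then show ?thesis
    by (rule mfd_smooth_on_cong[rotated])
      (use assms in \<open>simp_all add: inv_triv_T charts_at_iff Jv_def open_Int chart_open\<close>)
qed

definition Jfield :: "('m \<Rightarrow> ('m, 'n) chart \<Rightarrow> real^'n) \<Rightarrow> 'm \<Rightarrow> ('m, 'n) chart \<Rightarrow> real^'n" where
  "Jfield V = (\<lambda>p. Jv p (V p))"

lemma vf_Jfield: "V \<in> fields \<Longrightarrow> vf (Jfield V) = J \<circ> vf V"
  by (simp add: fun_eq_iff vf_def Jfield_def J_eq fields_fibre)

text \<open>\<open>bundle_map\<close> provides smoothness of \<open>J\<close> only on vectors that
  are constant in a trivialization, that is, of the columns of its matrix. The image of a field is a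
  combination of these columns whose coefficients are the smooth coordinates of the field.\<close>

lemma Jfield_closed:
  assumes V: "V \<in> fields"
  shows "Jfield V \<in> fields"
  unfolding fields_iff
proof (intro conjI allI ballI)
  show "(p, Jfield V p) \<in> fibre T p" for p
    using V by (simp add: Jfield_def Jv_fibre fields_fibre)
  fix c assume c: "c \<in> A"
  have eq: "Jfield V p c = (\<Sum>b\<in>Basis. (V p c \<bullet> b) *\<^sub>R Jv p (tvec_of c p b) c)" if "p \<in> fst c" for p
    using linear_expand_Basis[OF linear_Jv_tvec_of, of c p "V p c" c] that c V
    by (simp add: Jfield_def charts_at_iff tvec_of_eq fields_fibre)
  have "mfd_smooth_on A (fst c) (\<lambda>p. \<Sum>b\<in>Basis. (V p c \<bullet> b) *\<^sub>R Jv p (tvec_of c p b) c)"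
  proof (intro mfd_smooth_on_sum mfd_smooth_on_scaleR mfd_smooth_on_bounded_linear[OF _ bounded_linear_inner_left])
    show "mfd_smooth_on A (fst c) (\<lambda>p. Jv p (tvec_of c p b) c)" for b
      using mfd_smooth_on_Jv_tvec_of[OF c c] by simp
  qed (use c V in \<open>auto simp: chart_open fields_iff\<close>)
  then show "mfd_smooth_on A (fst c) (\<lambda>p. Jfield V p c)"
    by (rule mfd_smooth_on_cong[OF chart_open[OF c]]) (simp add: eq)
qed

abbreviation half where "half \<equiv> fscale (\<lambda>_. 1 / 2)"

lemma Jfield_torsion:
  assumes "V \<in> fields" "W \<in> fields"
  shows "fields_br (Jfield V) (Jfield W) =
    Jfield (fields_br (Jfield V) W) + Jfield (fields_br V (Jfield W)) + fields_br V W"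
proof
  fix p
  have minus: "sec_minus T (vf V) (vf W) = vf (V - W)" for V W
    by (simp add: sec_minus_def sec_add_def sec_scale_def vf_def fun_eq_iff)
  have "nijenhuis_torsion A J (vf V) (vf W) = vzero T"
    using J assms by (simp add: complex_structure_def fields_def)
  moreover have "nijenhuis_torsion A J (vf V) (vf W) = vf (fields_br (Jfield V) (Jfield W)
      - Jfield (fields_br (Jfield V) W) - Jfield (fields_br V (Jfield W)) - fields_br V W)"
    using assms by (simp add: nijenhuis_torsion_def Let_def vf_Jfield[symmetric] vf_fields_br[symmetric]
        minus Jfield_closed del: comp_apply)
  ultimately have "vf (fields_br (Jfield V) (Jfield W)
      - Jfield (fields_br (Jfield V) W) - Jfield (fields_br V (Jfield W)) - fields_br V W) p = (p, 0)"
    by simp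
  then show "fields_br (Jfield V) (Jfield W) p =
    (Jfield (fields_br (Jfield V) W) + Jfield (fields_br V (Jfield W)) + fields_br V W) p"
    by (simp add: vf_def algebra_simps)
qed

sublocale H: complex_lie_ring fields fields_br Jfield half
proof
  fix V W assume V: "V \<in> fields"
  show "Jfield V \<in> fields" using V by (rule Jfield_closed)
  show "Jfield (Jfield V) = - V"
    using V by (simp add: Jfield_def fun_eq_iff Jv_Jv fields_fibre)
  show "half V \<in> fields"
    using V by (intro fields_scale mfd_smooth_on_const)
  show "Jfield (half V) = half (Jfield V)"
    using Jv_scale[OF fields_fibre[OF V], of _ "1 / 2"] by (simp add: Jfield_def fscale_def)
  assume W: "W \<in> fields"
  show "Jfield (V + W) = Jfield V + Jfield W"
    using V W by (simp add: Jfield_def fun_eq_iff Jv_add fields_fibre)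
  show "fields_br (Jfield V) (Jfield W) =
    Jfield (fields_br (Jfield V) W) + Jfield (fields_br V (Jfield W)) + fields_br V W"
    using V W by (rule Jfield_torsion)
  show "fields_br (half V) W = half (fields_br V W)"
    using V W by (rule fields_br_scale_const)
next
  fix V W
  show "half (V + W) = half V + half W"
    by (simp add: fscale_def fun_eq_iff scaleR_add_right)
qed

end

section \<open>Complex vector fields\<close>

definition cvec :: "real^'n \<Rightarrow> real^'n \<Rightarrow> complex^'n" where
  "cvec a b = (\<chi> i. Complex (a $ i) (b $ i))"

definition vec_Re :: "complex^'n \<Rightarrow> real^'n" where
  "vec_Re w = (\<chi> i. Re (w $ i))"

definition vec_Im :: "complex^'n \<Rightarrow> real^'n" where
  "vec_Im w = (\<chi> i. Im (w $ i))"

lemma cvec_simps [simp]: "vec_Re (cvec a b) = a" "vec_Im (cvec a b) = b" "cvec (vec_Re w) (vec_Im w) = w"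
  by (simp_all add: cvec_def vec_Re_def vec_Im_def vec_eq_iff)

lemma bounded_linear_cvec:
  fixes w :: "complex^'n::finite"
  shows "bounded_linear (\<lambda>a. cvec a 0 :: complex^'n)" "bounded_linear (\<lambda>b. cvec 0 b :: complex^'n)"
    "bounded_linear (vec_Re :: complex^'n \<Rightarrow> _)" "bounded_linear (vec_Im :: complex^'n \<Rightarrow> _)"
  by (auto simp: linear_conv_bounded_linear[symmetric] cvec_def vec_Re_def vec_Im_def vec_eq_iff
      complex_eq_iff intro!: linearI)

text \<open>Writes \<open>cvec\<close> as a sum of two linear maps of one variable each, so that
  smoothness passes from the real and imaginary parts to the complex vector.\<close>

lemma cvec_split: "cvec a b = cvec a 0 + cvec 0 b"
  by (simp add: cvec_def vec_eq_iff complex_eq_iff)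

section \<open>The complexified tangent bundle and its sections\<close>

context smooth_manifold
begin

abbreviation CT where "CT \<equiv> ctangent_bundle A"

lemma mfd_smooth_on_cvec:
  assumes "open W" "mfd_smooth_on A W f" "mfd_smooth_on A W g"
  shows "mfd_smooth_on A W (\<lambda>p. cvec (f p) (g p))"
  by (subst cvec_split) (intro mfd_smooth_on_add mfd_smooth_on_bounded_linear[of W "\<lambda>a. cvec a 0"]
      mfd_smooth_on_bounded_linear[of W "\<lambda>a. cvec 0 a"] bounded_linear_cvec assms)

lemma mfd_smooth_on_cvecD:
  assumes "open W" "mfd_smooth_on A W (\<lambda>p. cvec (f p) (g p))"
  shows "mfd_smooth_on A W f" "mfd_smooth_on A W g"
  using mfd_smooth_on_bounded_linear[OF assms(1) bounded_linear_cvec(3) assms(2)]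
    mfd_smooth_on_bounded_linear[OF assms(1) bounded_linear_cvec(4) assms(2)] by simp_all

definition ctriv :: "('m, 'n) chart \<Rightarrow> ('m, 'n) ctvec \<Rightarrow> complex^'n" where
  "ctriv c e = cvec (snd (fst e) c) (snd (snd e) c)"

lemma CT_simps [simp]:
  "vadd CT ((p, v), (p, w)) ((p, v'), (p, w')) = ((p, v + v'), (p, w + w'))"
  "vzero CT p = ((p, 0), (p, 0))"
  "vscale CT a ((p, v), (p, w)) =
    ((p, \<lambda>c. Re a *\<^sub>R v c - Im a *\<^sub>R w c), (p, \<lambda>c. Re a *\<^sub>R w c + Im a *\<^sub>R v c))"
  "trivs CT = (\<lambda>c. (fst c, ctriv c)) ` A"
  by (simp_all add: complexification_def fun_eq_iff)
    (force simp: image_image ctriv_def cvec_def fun_eq_iff)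

lemma fibre_CT_iff: "e \<in> fibre CT p \<longleftrightarrow> fst e \<in> fibre T p \<and> snd e \<in> fibre T p"
  by (auto simp: fibre_def complexification_def case_prod_beta)

lemma fibre_CT_E:
  assumes "e \<in> fibre CT p"
  obtains v w where "e = ((p, v), (p, w))" "(p, v) \<in> fibre T p" "(p, w) \<in> fibre T p"
  using assms that by (metis fibre_CT_iff fibre_T_fst prod.collapse)

definition ctvec_of :: "('m, 'n) chart \<Rightarrow> 'm \<Rightarrow> complex^'n \<Rightarrow> ('m, 'n) ctvec" where
  "ctvec_of c p w = ((p, tvec_of c p (vec_Re w)), (p, tvec_of c p (vec_Im w)))"

lemma ctvec_of_fibre: "c \<in> charts_at A p \<Longrightarrow> ctvec_of c p w \<in> fibre CT p"
  by (simp add: fibre_CT_iff ctvec_of_def tvec_of_fibre)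

lemma ctriv_ctvec_of: "c \<in> charts_at A p \<Longrightarrow> ctriv c (ctvec_of c p w) = w"
  by (simp add: ctriv_def ctvec_of_def tvec_of_chart)

lemma ctvec_of_ctriv: "c \<in> charts_at A p \<Longrightarrow> e \<in> fibre CT p \<Longrightarrow> ctvec_of c p (ctriv c e) = e"
  by (erule fibre_CT_E) (simp add: ctriv_def ctvec_of_def tvec_of_eq)

lemma bij_betw_ctriv: "c \<in> charts_at A p \<Longrightarrow> bij_betw (ctriv c) (fibre CT p) UNIV"
  by (rule bij_betw_byWitness[where f' = "ctvec_of c p"])
    (simp_all add: ctvec_of_ctriv ctriv_ctvec_of image_subset_iff ctvec_of_fibre)

lemma inv_ctriv: "c \<in> charts_at A p \<Longrightarrow> inv_into (fibre CT p) (ctriv c) w = ctvec_of c p w"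
  by (rule inv_into_f_eq) (simp_all add: bij_betw_imp_inj_on[OF bij_betw_ctriv] ctvec_of_fibre ctriv_ctvec_of)

lemma fibre_CT_vadd: "e \<in> fibre CT p \<Longrightarrow> e' \<in> fibre CT p \<Longrightarrow> vadd CT e e' \<in> fibre CT p"
  by (elim fibre_CT_E) (simp add: fibre_CT_iff fibre_T_add)

lemma fibre_CT_vscale:
  assumes "e \<in> fibre CT p"
  shows "vscale CT a e \<in> fibre CT p"
proof -
  obtain v w where e: "e = ((p, v), (p, w))" and vw: "(p, v) \<in> fibre T p" "(p, w) \<in> fibre T p"
    using assms by (rule fibre_CT_E)
  show ?thesis
    using fibre_T_comb[OF vw, of "Re a" "- Im a"] fibre_T_comb[OF vw(2,1), of "Re a" "Im a"]
    by (simp add: e fibre_CT_iff)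
qed

lemma ctriv_linear:
  assumes "e \<in> fibre CT p" "e' \<in> fibre CT p"
  shows "ctriv c (vadd CT e e') = ctriv c e + ctriv c e'" "ctriv c (vscale CT a e) = a *s ctriv c e"
  using assms by (auto elim!: fibre_CT_E simp: ctriv_def cvec_def vec_eq_iff complex_eq_iff)

lemma ctriv_zero: "ctriv c (vzero CT p) = 0"
  by (simp add: ctriv_def cvec_def vec_eq_iff complex_eq_iff)

lemma vector_bundle_CT: "vector_bundle A CT"
proof -
  have "(\<Union>c\<in>A. fst c) = UNIV"
    using atlas unfolding smooth_atlas_def by blast
  moreover have "vzero CT p \<in> fibre CT p" for p
    by (simp add: fibre_CT_iff fibre_T_zero)
  moreover have "mfd_smooth_on A (fst c \<inter> fst d) (\<lambda>p. ctriv d (inv_into (fibre CT p) (ctriv c) w))"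
    if cd: "c \<in> A" "d \<in> A" for c d w
  proof (rule mfd_smooth_on_cong)
    show "open (fst c \<inter> fst d)"
      using cd by (intro open_Int chart_open)
    \<comment> \<open>A transition function of the complexification acts on real and imaginary parts
      by the same real transition derivative.\<close>
    then show "mfd_smooth_on A (fst c \<inter> fst d) (\<lambda>p. ctriv d (ctvec_of c p w))"
      unfolding ctriv_def ctvec_of_def fst_conv snd_conv
      using cd by (intro mfd_smooth_on_cvec mfd_smooth_on_tvec_of)
  qed (use cd in \<open>simp add: inv_ctriv charts_at_iff\<close>)
  ultimately show ?thesis
    unfolding vector_bundle_def CT_simps(4)
    by (simp add: fibre_CT_vadd fibre_CT_vscale chart_open bij_betw_ctriv charts_at_iff ctriv_linear
        ctriv_zero del: CT_simps(1-3))
qed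

text \<open>\<open>cvf (X, Y)\<close> is the complex vector field \<open>X + i Y\<close>, and \<open>cscale f\<close> is multiplication by the
  complex function \<open>f\<close>.\<close>

definition cvf ::
    "('m \<Rightarrow> ('m, 'n) chart \<Rightarrow> real^'n) \<times> ('m \<Rightarrow> ('m, 'n) chart \<Rightarrow> real^'n) \<Rightarrow> 'm \<Rightarrow> ('m, 'n) ctvec" where
  "cvf z = (\<lambda>p. (vf (fst z) p, vf (snd z) p))"

definition cscale ::
    "('m \<Rightarrow> complex) \<Rightarrow> ('m \<Rightarrow> ('m, 'n) chart \<Rightarrow> real^'n) \<times> ('m \<Rightarrow> ('m, 'n) chart \<Rightarrow> real^'n) \<Rightarrow>
      ('m \<Rightarrow> ('m, 'n) chart \<Rightarrow> real^'n) \<times> ('m \<Rightarrow> ('m, 'n) chart \<Rightarrow> real^'n)" where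
  "cscale f z = (fscale (\<lambda>p. Re (f p)) (fst z) - fscale (\<lambda>p. Im (f p)) (snd z),
     fscale (\<lambda>p. Re (f p)) (snd z) + fscale (\<lambda>p. Im (f p)) (fst z))"

abbreviation "cbr \<equiv> complexify_br fields_br"

text \<open>The bridge to the algebra: statements about complex sections become statements about
  pairs in \<open>fields \<times> fields\<close>, where sums, negatives and \<open>cbr\<close> are
  available.\<close>

lemma sections_CT: "sections A CT = cvf ` (fields \<times> fields)"
proof (intro set_eqI iffI)
  fix Z assume Z: "Z \<in> sections A CT"
  let ?z = "(\<lambda>p. snd (fst (Z p)), \<lambda>p. snd (snd (Z p)))"
  have fibre: "fst (Z p) \<in> fibre T p" "snd (Z p) \<in> fibre T p" for p
    using Z by (auto simp: sections_def fibre_CT_iff)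
  then have eq: "(p, snd (fst (Z p))) = fst (Z p)" "(p, snd (snd (Z p))) = snd (Z p)" for p
    by (metis fibre_T_fst prod.collapse)+
  have "mfd_smooth_on A (fst c) (\<lambda>p. cvec (snd (fst (Z p)) c) (snd (snd (Z p)) c))" if "c \<in> A" for c
    using Z that by (auto simp: sections_def ctriv_def[abs_def] comp_def)
  note smooth = mfd_smooth_on_cvecD[OF chart_open this]
  have "?z \<in> fields \<times> fields"
    using smooth fibre by (simp add: fields_iff eq)
  moreover have "Z = cvf ?z"
    by (simp add: cvf_def vf_def eq)
  ultimately show "Z \<in> cvf ` (fields \<times> fields)"
    by blast
next
  fix Z assume "Z \<in> cvf ` (fields \<times> fields)"
  then obtain z where z: "fst z \<in> fields" "snd z \<in> fields" "Z = cvf z"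
    by auto
  show "Z \<in> sections A CT"
    using z unfolding sections_def CT_simps(4)
    by (auto simp: fields_iff fibre_CT_iff cvf_def vf_def ctriv_def[abs_def] comp_def intro!: mfd_smooth_on_cvec chart_open)
qed

lemma cvf_add: "sec_add CT (cvf z) (cvf w) = cvf (z + w)"
  by (simp add: sec_add_def cvf_def vf_def)

lemma cvf_scale: "sec_scale CT f (cvf z) = cvf (cscale f z)"
  by (simp add: sec_scale_def cvf_def vf_def cscale_def fscale_def fun_eq_iff)

lemma cscale_const_simps [simp]: "cscale (\<lambda>_. 0) z = 0" "cscale (\<lambda>_. - 1) z = - z"
  by (simp_all add: cscale_def prod_eq_iff)

lemma cvf_minus: "sec_minus CT (cvf z) (cvf w) = cvf (z - w)"
  by (simp add: sec_minus_def cvf_scale cvf_add)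

lemma cvf_zero: "vzero CT = cvf 0"
  by (simp add: cvf_def vf_def fun_eq_iff)

lemma cvf_cbr: "clie_bracket A (cvf z) (cvf w) = cvf (cbr z w)"
proof -
  have "fst \<circ> cvf z = vf (fst z)" "snd \<circ> cvf z = vf (snd z)" for z
    by (simp_all add: cvf_def fun_eq_iff)
  then show ?thesis
    unfolding clie_bracket_def Let_def
    by (simp add: vf_fields_br[symmetric] sec_minus_def sec_add_def sec_scale_def)
      (simp add: cvf_def vf_def complexify_br_def fun_eq_iff)
qed

text \<open>Kept general in \<open>N\<close> because it serves both \<open>p_plus A J\<close> and
  \<open>complexify_end J\<close>, the two endomorphisms in the final formula.\<close>

lemma cvf_contracted_bracket:
  assumes "\<And>z. z \<in> fields \<times> fields \<Longrightarrow> N \<circ> cvf z = cvf (N' z)"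
    and "z \<in> fields \<times> fields" "w \<in> fields \<times> fields"
  shows "contracted_bracket A N (cvf z) (cvf w) = cvf (contraction cbr N' z w)"
proof -
  interpret C: lie_ring_on "fields \<times> fields" cbr
    by (rule F.complexify_lie_ring)
  show ?thesis
    using assms by (simp add: contracted_bracket_def Let_def cvf_cbr cvf_add cvf_minus contraction_def)
qed

lemma tangent_act_complex:
  assumes f: "mfd_smooth_on A UNIV f" and e: "e \<in> fibre T p"
  shows "Re (tangent_act A e f) = tangent_act A e (\<lambda>p. Re (f p))"
    "Im (tangent_act A e f) = tangent_act A e (\<lambda>p. Im (f p))"
proof -
  obtain c where c: "c \<in> charts_at A p"
    by (rule chart_cover)
  have smooth: "mfd_smooth_on A UNIV (\<lambda>p. Re (f p))" "mfd_smooth_on A UNIV (\<lambda>p. Im (f p))"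
    using f by (auto intro: mfd_smooth_on_bounded_linear bounded_linear_Re bounded_linear_Im)
  have "smooth_on (snd c ` fst c) (f \<circ> chart_inv c)"
    using mfd_smooth_onD[OF mfd_smooth_on_subset[OF f], of "fst c" c] c by (simp add: charts_at_iff)
  then have D: "((f \<circ> chart_inv c) has_derivative frechet_derivative (f \<circ> chart_inv c) (at (snd c p))) (at (snd c p))"
    by (rule smooth_on_has_derivative[OF _ charts_at_image[OF c]])
  have "tangent_act A e (\<lambda>p. h (f p)) = h (tangent_act A e f)"
    if "bounded_linear h" "mfd_smooth_on A UNIV (\<lambda>p. h (f p))" for h :: "complex \<Rightarrow> real"
    using frechet_derivative_eqI[OF bounded_linear.has_derivative[OF that(1) D]]
      tangent_act_chart[OF f e c] tangent_act_chart[OF that(2) e c]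
    by (simp add: comp_def)
  then show "Re (tangent_act A e f) = tangent_act A e (\<lambda>p. Re (f p))"
    "Im (tangent_act A e f) = tangent_act A e (\<lambda>p. Im (f p))"
    using smooth bounded_linear_Re bounded_linear_Im by simp_all
qed

text \<open>The real Leibniz rule is applied to \<open>Re f\<close> and \<open>Im f\<close> along
  both components of \<open>z\<close>. The resulting derivatives assemble into
  \<open>cfield_act\<close> because taking real and imaginary parts commutes with
  differentiation.\<close>

lemma cbr_scale_right:
  assumes z: "z \<in> fields \<times> fields" and w: "w \<in> fields \<times> fields" and f: "mfd_smooth_on A UNIV f"
  shows "cbr z (cscale f w) = cscale f (cbr z w) + cscale (cfield_act A (cvf z) f) w"
proof -
  have f': "mfd_smooth_on A UNIV (\<lambda>p. Re (f p))" "mfd_smooth_on A UNIV (\<lambda>p. Im (f p))"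
    using f by (auto intro: mfd_smooth_on_bounded_linear bounded_linear_Re bounded_linear_Im)
  have S: "fst z \<in> fields" "snd z \<in> fields" "fst w \<in> fields" "snd w \<in> fields"
    using z w by auto
  have fib: "vf (fst z) p \<in> fibre T p" "vf (snd z) p \<in> fibre T p" for p
    using S by (simp_all add: vf_def fields_fibre)
  show ?thesis
    using S f' unfolding complexify_br_def cscale_def
    by (simp add: F.br_simps fields_scale fields_br_scale_right cfield_act_def cvf_def
        tangent_act_complex[OF f fib(1)] tangent_act_complex[OF f fib(2)])
      (simp add: fun_eq_iff fscale_apply algebra_simps)
qed

text \<open>Makes Z(f) an admissible coefficient: Z(f) W is then a smooth field, to which the
  additivity of \<open>half_plus\<close> applies.\<close>

lemma mfd_smooth_on_cfield_act:
  assumes "z \<in> fields \<times> fields" "mfd_smooth_on A UNIV f"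
  shows "mfd_smooth_on A UNIV (cfield_act A (cvf z) f)"
  using assms unfolding cfield_act_def cvf_def fst_conv snd_conv
  by (intro mfd_smooth_on_add mfd_smooth_on_bounded_linear[OF open_UNIV bounded_linear_mult_right]
      mfd_smooth_on_tangent_act open_UNIV) auto

lemma cscale_closed:
  assumes "z \<in> fields \<times> fields" "mfd_smooth_on A UNIV f"
  shows "cscale f z \<in> fields \<times> fields"
proof -
  have f': "mfd_smooth_on A UNIV (\<lambda>p. Re (f p))" "mfd_smooth_on A UNIV (\<lambda>p. Im (f p))"
    using assms(2) by (auto intro: mfd_smooth_on_bounded_linear bounded_linear_Re bounded_linear_Im)
  then show ?thesis
    using assms(1) by (auto simp: cscale_def fields_scale)
qed

end

section \<open>The anchor \<open>p_plus\<close> and the bracket it induces\<close>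

context complex_manifold
begin

lemma Jv_comb:
  assumes "(p, v) \<in> fibre T p" "(p, w) \<in> fibre T p"
  shows "Jv p (\<lambda>c. r *\<^sub>R v c + s *\<^sub>R w c) = (\<lambda>c. r *\<^sub>R Jv p v c + s *\<^sub>R Jv p w c)"
proof -
  have "Jv p ((\<lambda>c. r *\<^sub>R v c) + (\<lambda>c. s *\<^sub>R w c)) = (\<lambda>c. r *\<^sub>R Jv p v c) + (\<lambda>c. s *\<^sub>R Jv p w c)"
    using assms by (simp add: Jv_add Jv_scale fibre_T_scale)
  then show ?thesis
    by (simp add: plus_fun_def)
qed

lemma p_plus_eq:
  assumes "(p, v) \<in> fibre T p" "(p, w) \<in> fibre T p"
  shows "p_plus A J ((p, v), (p, w)) =
    ((p, \<lambda>c. (1 / 2) *\<^sub>R (v c + Jv p w c)), (p, \<lambda>c. (1 / 2) *\<^sub>R (w c - Jv p v c)))"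
  using assms by (simp add: p_plus_def Let_def complexify_end_def J_eq)

lemma p_plus_fibre: "e \<in> fibre CT p \<Longrightarrow> p_plus A J e \<in> fibre CT p"
  unfolding p_plus_def Let_def
  by (intro fibre_CT_vadd fibre_CT_vscale)
    (auto simp: complexify_end_def fibre_CT_iff J_fibre)

lemma bundle_map_p_plus: "bundle_map A CT CT (p_plus A J)"
proof -
  have add: "p_plus A J (vadd CT e e') = vadd CT (p_plus A J e) (p_plus A J e')"
    if e: "e \<in> fibre CT p" "e' \<in> fibre CT p" for p e e'
  proof -
    obtain v w v' w' where *: "e = ((p, v), (p, w))" "(p, v) \<in> fibre T p" "(p, w) \<in> fibre T p"
      "e' = ((p, v'), (p, w'))" "(p, v') \<in> fibre T p" "(p, w') \<in> fibre T p"
      using e by (elim fibre_CT_E)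
    then show ?thesis
      by (simp add: p_plus_eq fibre_T_add Jv_add fun_eq_iff algebra_simps)
  qed
  have scale: "p_plus A J (vscale CT a e) = vscale CT a (p_plus A J e)"
    if e: "e \<in> fibre CT p" for p e a
  proof -
    obtain v w where *: "e = ((p, v), (p, w))" "(p, v) \<in> fibre T p" "(p, w) \<in> fibre T p"
      using e by (rule fibre_CT_E)
    \<comment> \<open>Writing the subtraction as addition of \<open>(- Im a)\<close> times a vector
      gives both components the shape expected by \<open>fibre_T_comb\<close> and
      \<open>Jv_comb\<close>.\<close>
    have "vscale CT a e = ((p, \<lambda>c. Re a *\<^sub>R v c + (- Im a) *\<^sub>R w c), (p, \<lambda>c. Re a *\<^sub>R w c + Im a *\<^sub>R v c))"
      using * by simp
    then have "p_plus A J (vscale CT a e) =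
      ((p, \<lambda>c. (1 / 2) *\<^sub>R ((Re a *\<^sub>R v c + (- Im a) *\<^sub>R w c) + (Re a *\<^sub>R Jv p w c + Im a *\<^sub>R Jv p v c))),
       (p, \<lambda>c. (1 / 2) *\<^sub>R ((Re a *\<^sub>R w c + Im a *\<^sub>R v c) - (Re a *\<^sub>R Jv p v c + (- Im a) *\<^sub>R Jv p w c))))"
      using * by (simp only: p_plus_eq fibre_T_comb Jv_comb)
    also have "\<dots> = vscale CT a (p_plus A J e)"
      unfolding *(1) p_plus_eq[OF *(2,3)] CT_simps by (simp add: fun_eq_iff algebra_simps)
    finally show ?thesis .
  qed
  have smooth: "mfd_smooth_on A (fst c \<inter> fst d) (\<lambda>p. ctriv d (p_plus A J (inv_into (fibre CT p) (ctriv c) w)))"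
    if cd: "c \<in> A" "d \<in> A" for c d w
  proof (rule mfd_smooth_on_cong)
    show W: "open (fst c \<inter> fst d)"
      using cd by (intro open_Int chart_open)
    \<comment> \<open>The explicit form of \<open>p_plus\<close> on a vector constant in chart
      \<open>c\<close>, read in chart \<open>d\<close>: its ingredients are transition derivatives
      and columns of \<open>J\<close>, both known to be smooth.\<close>
    show "mfd_smooth_on A (fst c \<inter> fst d) (\<lambda>p. cvec
       ((1 / 2) *\<^sub>R (tvec_of c p (vec_Re w) d + Jv p (tvec_of c p (vec_Im w)) d))
       ((1 / 2) *\<^sub>R (tvec_of c p (vec_Im w) d - Jv p (tvec_of c p (vec_Re w)) d)))"
      using cd W by (intro mfd_smooth_on_cvec mfd_smooth_on_scaleR mfd_smooth_on_const mfd_smooth_on_add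
          mfd_smooth_on_diff mfd_smooth_on_tvec_of mfd_smooth_on_Jv_tvec_of)
  next
    fix p assume "p \<in> fst c \<inter> fst d"
    then have c: "c \<in> charts_at A p"
      using cd by (simp add: charts_at_iff)
    then show "cvec ((1 / 2) *\<^sub>R (tvec_of c p (vec_Re w) d + Jv p (tvec_of c p (vec_Im w)) d))
       ((1 / 2) *\<^sub>R (tvec_of c p (vec_Im w) d - Jv p (tvec_of c p (vec_Re w)) d)) =
       ctriv d (p_plus A J (inv_into (fibre CT p) (ctriv c) w))"
      unfolding inv_ctriv[OF c] ctvec_of_def p_plus_eq[OF tvec_of_fibre[OF c] tvec_of_fibre[OF c]] ctriv_def
      by simp
  qed
  show ?thesis
    unfolding bundle_map_def CT_simps(4)
    using add scale smooth by (auto simp: p_plus_fibre simp del: CT_simps)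
qed

lemma cvf_p_plus: "z \<in> fields \<times> fields \<Longrightarrow> p_plus A J \<circ> cvf z = cvf (H.half_plus z)"
  by (auto simp: fun_eq_iff cvf_def vf_def p_plus_eq fields_fibre H.half_plus_def fscale_apply Jfield_def)

lemma cvf_complexify_end:
  "z \<in> fields \<times> fields \<Longrightarrow> complexify_end J \<circ> cvf z = cvf (map_prod Jfield Jfield z)"
  by (auto simp: fun_eq_iff cvf_def complexify_end_def vf_Jfield)

text \<open>Tensoriality: \<open>J\<close> acts fibre by fibre, so coefficients that vary with the
  point pass through it.\<close>

lemma Jfield_linear:
  assumes "V \<in> fields" "W \<in> fields"
  shows "Jfield (fscale g V + fscale h W) = fscale g (Jfield V) + fscale h (Jfield W)"
proof
  fix p
  have "Jv p (fscale g V p + fscale h W p) = Jv p (\<lambda>c. g p *\<^sub>R V p c + h p *\<^sub>R W p c)"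
    by (simp add: fscale_def plus_fun_def)
  then show "Jfield (fscale g V + fscale h W) p = (fscale g (Jfield V) + fscale h (Jfield W)) p"
    using Jv_comb[OF fields_fibre[OF assms(1), of p] fields_fibre[OF assms(2)], of "g p" "h p"]
    by (simp add: Jfield_def fscale_def plus_fun_def)
qed

text \<open>Linearity over functions, not just constants. Hence in the Leibniz rule for the
  contraction only the brackets produce derivatives of \<open>f\<close>.\<close>

lemma half_plus_cscale:
  assumes "z \<in> fields \<times> fields"
  shows "H.half_plus (cscale f z) = cscale f (H.half_plus z)"
proof -
  have S: "fst z \<in> fields" "snd z \<in> fields"
    using assms by auto
  have diff: "fscale g V - fscale h W = fscale g V + fscale (\<lambda>p. - h p) W" for g V h W
    by (simp add: fun_eq_iff fscale_apply)
  show ?thesis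
    unfolding H.half_plus_def cscale_def fst_conv snd_conv diff Jfield_linear[OF S] Jfield_linear[OF S(2,1)]
    by (simp add: fun_eq_iff fscale_apply algebra_simps)
qed

sublocale P: lie_ring_endo "fields \<times> fields" cbr H.half_plus
  by (rule H.half_plus_endo)

abbreviation K where "K \<equiv> contraction cbr H.half_plus"

lemma K_cscale_right:
  assumes z: "z \<in> fields \<times> fields" and w: "w \<in> fields \<times> fields" and f: "mfd_smooth_on A UNIV f"
  shows "K z (cscale f w) = cscale f (K z w) + cscale (cfield_act A (p_plus A J \<circ> cvf z) f) w"
proof -
  \<comment> \<open>The second summand is what the subtracted term of the contraction contributes;
    its counterpart arises from \<open>cbr z (H.half_plus (cscale f w))\<close> after
    \<open>half_plus_cscale\<close>.\<close>
  have "H.half_plus (cbr z (cscale f w)) =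
      cscale f (H.half_plus (cbr z w)) + cscale (cfield_act A (cvf z) f) (H.half_plus w)"
    using z w f by (simp add: cbr_scale_right P.N_add cscale_closed mfd_smooth_on_cfield_act half_plus_cscale del: mem_Sigma_iff)
  moreover have "cscale f (u + v - u') = cscale f u + cscale f v - cscale f u'" for u v u'
    by (simp add: cscale_def prod_eq_iff fun_eq_iff fscale_apply algebra_simps)
  ultimately show ?thesis
    using z w f unfolding contraction_def cvf_p_plus[OF z]
    by (simp add: cbr_scale_right half_plus_cscale del: mem_Sigma_iff)
qed

lemma K_const_right:
  assumes "z \<in> fields \<times> fields" "w \<in> fields \<times> fields"
  shows "K z (cscale (\<lambda>_. a) w) = cscale (\<lambda>_. a) (K z w)"
  using K_cscale_right[OF assms mfd_smooth_on_const, of a]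
  by (simp add: cfield_act_def tangent_act_const)

lemma K_const_left:
  assumes z: "z \<in> fields \<times> fields" and w: "w \<in> fields \<times> fields"
  shows "K (cscale (\<lambda>_. a) z) w = cscale (\<lambda>_. a) (K z w)"
proof -
  have "K (cscale (\<lambda>_. a) z) w = - cscale (\<lambda>_. a) (K w z)"
    using P.contraction_antisym[OF cscale_closed[OF z mfd_smooth_on_const] w, of a] K_const_right[OF w z, of a]
    by simp
  also have "\<dots> = cscale (\<lambda>_. a) (K z w)"
    using P.contraction_antisym[OF z w] by (simp add: cscale_def prod_eq_iff fun_eq_iff fscale_apply)
  finally show ?thesis .
qed

lemma cvf_K:
  "z \<in> fields \<times> fields \<Longrightarrow> w \<in> fields \<times> fields \<Longrightarrow>
    contracted_bracket A (p_plus A J) (cvf z) (cvf w) = cvf (K z w)"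
  by (rule cvf_contracted_bracket[OF cvf_p_plus])

text \<open>The contraction depends linearly on the endomorphism, and contracting by the identity
  returns the bracket itself, since two of its three copies cancel. Substituting
  \<open>\<onehalf> (1 - i J)\<close> gives the formula.\<close>

lemma K_eq:
  assumes "z \<in> fields \<times> fields" "w \<in> fields \<times> fields"
  shows "K z w = cscale (\<lambda>_. 1 / 2)
    (cbr z w - cscale (\<lambda>_. \<i>) (contraction cbr (map_prod Jfield Jfield) z w))"
proof -
  have "fst z \<in> fields" "snd z \<in> fields" "fst w \<in> fields" "snd w \<in> fields"
    using assms by auto
  note [simp] = this
  show ?thesis
    by (simp add: contraction_def complexify_br_def H.half_plus_def cscale_def H.half_br H.half_br_right
        F.br_simps H.N_simps H.half_add H.half_diff H.half_minus prod_eq_iff map_prod_def case_prod_beta)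
qed

lemma complex_lie_algebra_CT: "complex_lie_algebra_on A CT (contracted_bracket A (p_plus A J))"
  unfolding complex_lie_algebra_on_def Let_def sections_CT ball_simps
  by (simp add: cvf_K cvf_add cvf_scale cvf_zero K_const_left K_const_right P.contraction_add_left
      P.contraction_add_right P.contraction_self H.half_plus_jacobi cscale_closed mfd_smooth_on_const del: mem_Sigma_iff)

lemma complex_lie_algebroid_CT:
  "complex_lie_algebroid A CT (p_plus A J) (contracted_bracket A (p_plus A J))"
  unfolding complex_lie_algebroid_def
proof (intro conjI vector_bundle_CT complex_lie_algebra_CT bundle_map_p_plus ballI allI impI)
  fix a b and f :: "'m \<Rightarrow> complex"
  assume "a \<in> sections A CT" "b \<in> sections A CT" "mfd_smooth_on A UNIV f"
  then show "contracted_bracket A (p_plus A J) a (sec_scale CT f b) =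
      sec_add CT (sec_scale CT f (contracted_bracket A (p_plus A J) a b))
        (sec_scale CT (cfield_act A (p_plus A J \<circ> a) f) b)"
    unfolding sections_CT
    by (elim imageE) (simp add: cvf_K cvf_add cvf_scale cscale_closed K_cscale_right del: mem_Sigma_iff)
qed

lemma contracted_bracket_p_plus:
  assumes "Z \<in> sections A CT" "W \<in> sections A CT"
  shows "contracted_bracket A (p_plus A J) Z W =
    sec_scale CT (\<lambda>_. 1 / 2) (sec_minus CT (clie_bracket A Z W)
      (sec_scale CT (\<lambda>_. \<i>) (contracted_bracket A (complexify_end J) Z W)))"
  using assms unfolding sections_CT
  by (elim imageE) (simp add: cvf_K cvf_cbr cvf_scale cvf_minus cvf_contracted_bracket[OF cvf_complexify_end] K_eq
      del: mem_Sigma_iff)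

end

theorem theorem7p3:
  fixes A :: "('m::{t2_space, second_countable_topology}, 'n::finite) chart set"
    and J :: "('m, 'n) tvec \<Rightarrow> ('m, 'n) tvec"
  assumes "smooth_atlas A"
    and "complex_structure A J"
  shows "complex_lie_algebroid A (ctangent_bundle A) (p_plus A J) (contracted_bracket A (p_plus A J)) \<and>
         (\<forall>Z\<in>sections A (ctangent_bundle A). \<forall>W\<in>sections A (ctangent_bundle A).
           contracted_bracket A (p_plus A J) Z W =
           sec_scale (ctangent_bundle A) (\<lambda>_. 1 / 2)
             (sec_minus (ctangent_bundle A)
                (clie_bracket A Z W)
                (sec_scale (ctangent_bundle A) (\<lambda>_. \<i>)
                   (contracted_bracket A (complexify_end J) Z W))))"
proof -
  interpret complex_manifold A J
    using assms by unfold_locales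
  show ?thesis
    using complex_lie_algebroid_CT contracted_bracket_p_plus by blast
qed

end
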